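(* Let $d,n\in\mathbb{N}$ with $n\ge2$, let $t=1$, let $0<\varepsilon<6$ and $\delta\in(0,1]$. For $k\in\mathbb{N}$ put $$\gamma=\gamma(k)=\begin{cases}\max\Big\{\dfrac{14\,dk\log(2/\delta)}{(n-1)\varepsilon^{2}},\ \dfrac{27\,dk}{(n-1)\varepsilon}\Big\}, & \text{when } \varepsilon<1,\\[3mm] \max\Big\{\dfrac{80\,dk\log(2/\delta)}{(n-1)\varepsilon^{2}},\ \dfrac{36\,dk}{11(n-1)\varepsilon}\Big\}, & \text{when } 1\le\varepsilon<6,\end{cases}$$ and assume that $\gamma(k)<1$ for at least one $k\in\mathbb{N}$. Then there exists a parameter $k$ with $\gamma=\gamma(k)<1$ such that the protocol $\mathcal{P}_{d,k,n,1}$, run with this $\gamma$, is $(\varepsilon,\delta)$-differentially private and $$\widehat{\mathrm{MSE}}(\mathcal{P}_{d,k,n,1})\le\begin{cases}\max\Big\{\dfrac{98^{1/3}d^{8/3}\log^{2/3}(2/\delta)}{(1-\gamma)^{2}n^{5/3}\varepsilon^{4/3}},\ \dfrac{18\,d^{8/3}}{(1-\gamma)^{2}n^{5/3}(4\varepsilon)^{2/3}}\Big\}, & \text{when } \varepsilon<1,\\[3mm] \max\Big\{\dfrac{2d^{8/3}(20\log(2/\delta))^{2/3}}{(1-\gamma)^{2}n^{5/3}\varepsilon^{4/3}},\ \dfrac{2\cdot 9^{2/3}\,d^{8/3}}{(1-\gamma)^{2}n^{5/3}(11\varepsilon)^{2/3}}\Big\}, & \text{when } 1\le\varepsilon<6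.\end{cases}$$
   Context: Datasets are $\vec D=(\vec x_1,\dots,\vec x_n)$ with $\vec x_i=(x_i^{(1)},\dots,x_i^{(d)})\in[0,1]^d$. Two datasets are neighbouring, $\vec D\simeq\vec D'$, if they differ only in the vector of a single user. A randomized mechanism $\mathcal{M}$ is $(\varepsilon,\delta)$-differentially private if for all $\vec D\simeq\vec D'$ and all events $E$, $\Pr[\mathcal{M}(\vec D)\in E]\le e^{\varepsilon}\Pr[\mathcal{M}(\vec D')\in E]+\delta$. The protocol $\mathcal{P}_{d,k,n,1}=(\mathcal{R}_{d,k,n,1},\mathcal{A}_{d,k,1})$ outputs $\mathcal{A}_{d,k,1}(\mathcal{S}(\mathcal{R}_{d,k,n,1}(\vec x_1),\dots,\mathcal{R}_{d,k,n,1}(\vec x_n)))$; calling it $(\varepsilon,\delta)$-differentially private means that the shuffled messages (and hence the output) are $(\varepsilon,\delta)$-differentially private. Local randomizer $\mathcal{R}_{d,k,n,1}$ (with parameter $\gamma$), applied by each user $i$ independently to $\vec x_i$: (1) sample one coordinate $\alpha_i\in[d]=\{1,\dots,d\}$ uniformly; (2) round: $\bar x_i^{(\alpha_i)}=\lfloor x_i^{(\alpha_i)}k\rfloor+\mathrm{Ber}\big(x_i^{(\alpha_i)}k-\lfloor x_i^{(\alpha_i)}k\rfloor\big)$; (3) set $y_i^{(\alpha_i)}=\bar x_i^{(\alpha_i)}$ with probability $1-\gamma$ and let $y_i^{(\alpha_i)}$ be uniformly random in $\{0,1,\dots,k\}$ with probability $\gamma$. The user's single message is $y_i^{(\alpha_i)}$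 together with its coordinate label $\alpha_i$. Shuffler $\mathcal{S}$: uniformly random permutation of the $n$ messages. Analyzer $\mathcal{A}_{d,k,1}$: for each $l\in[d]$ let $\hat z^{(l)}=\frac1k\sum_i y_i^{(l)}$, where $y_i^{(l)}=0$ if user $i$ did not sample coordinate $l$; output $z^{(l)}=\mathrm{DeBias}(\hat z^{(l)})=\big(\hat z^{(l)}-\frac{\gamma}{2}c_l\big)/(1-\gamma)$, where $c_l$ is the number of submissions received for coordinate $l$. Error: with $e_l$ the $l$-th standard basis vector of $\mathbb{R}^d$, $$\mathrm{MSE}(\mathcal{P}_{d,k,n,1})=\sup_{\vec D}\ \mathbb{E}\Big[\Big\|\sum_{l=1}^d \mathrm{DeBias}(\hat z^{(l)})\,e_l-\sum_{i=1}^n x_i^{(\alpha_{i})}e_{\alpha_{i}}\Big\|_2^2\Big],$$ with expectation over all randomness of the protocol, and $\widehat{\mathrm{MSE}}=\mathrm{MSE}/(n/d)^2$. Here $\log$ is the natural logarithm. *)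

theory Defs
  imports "HOL-Probability.Probability" "HOL-Combinatorics.Combinatorics"
begin

text \<open>
  Coordinates are the elements of a finite type \<open>'d\<close>, so the dimension is \<open>CARD('d)\<close>.
  Users are numbered \<open>0, \<dots>, n - 1\<close>.
\<close>

type_synonym 'd dataset = "nat \<Rightarrow> real ^ 'd"
type_synonym 'd message = "'d \<times> nat"

definition datasets :: "nat \<Rightarrow> 'd::finite dataset set" where
  "datasets n = {..<n} \<rightarrow>\<^sub>E {x. \<forall>l. x $ l \<in> {0..1}}"

definition neighbouring :: "nat \<Rightarrow> 'd::finite dataset \<Rightarrow> 'd dataset \<Rightarrow> bool" where
  "neighbouring n D D' \<longleftrightarrow> D \<in> datasets n \<and> D' \<in> datasets n \<and>
     (\<exists>j<n. \<forall>i<n. i \<noteq> j \<longrightarrow> D i = D' i)"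

definition differentially_private ::
    "('a \<Rightarrow> 'a \<Rightarrow> bool) \<Rightarrow> ('a \<Rightarrow> 'b pmf) \<Rightarrow> real \<Rightarrow> real \<Rightarrow> bool" where
  "differentially_private neigh M \<epsilon> \<delta> \<longleftrightarrow>
     (\<forall>D D' E. neigh D D' \<longrightarrow>
        measure_pmf.prob (M D) E \<le> exp \<epsilon> * measure_pmf.prob (M D') E + \<delta>)"

definition randomizer :: "nat \<Rightarrow> real \<Rightarrow> real ^ 'd::finite \<Rightarrow> 'd message pmf" where
  "randomizer k \<gamma> x = do {
     \<alpha> \<leftarrow> pmf_of_set UNIV;
     b \<leftarrow> bernoulli_pmf (x $ \<alpha> * real k - of_int \<lfloor>x $ \<alpha> * real k\<rfloor>);
     let xbar = nat \<lfloor>x $ \<alpha> * real k\<rfloor> + of_bool b;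
     blanket \<leftarrow> bernoulli_pmf \<gamma>;
     y \<leftarrow> (if blanket then pmf_of_set {0..k} else return_pmf xbar);
     return_pmf (\<alpha>, y)
   }"

definition shuffler :: "'a list \<Rightarrow> 'a list pmf" where
  "shuffler ms = map_pmf (\<lambda>\<pi>. permute_list \<pi> ms) (pmf_of_set {\<pi>. \<pi> permutes {..<length ms}})"

text \<open>
  The joint law of the users' messages and the shuffled list. The messages themselves are kept
  because the error refers to the coordinate that each individual user sampled.
\<close>

definition transcript ::
    "nat \<Rightarrow> real \<Rightarrow> nat \<Rightarrow> 'd::finite dataset \<Rightarrow> ((nat \<Rightarrow> 'd message) \<times> 'd message list) pmf" where
  "transcript k \<gamma> n D = do {
     r \<leftarrow> Pi_pmf {..<n} undefined (\<lambda>i. randomizer k \<gamma> (D i));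
     s \<leftarrow> shuffler (map r [0..<n]);
     return_pmf (r, s)
   }"

definition shuffled_messages ::
    "nat \<Rightarrow> real \<Rightarrow> nat \<Rightarrow> 'd::finite dataset \<Rightarrow> 'd message list pmf" where
  "shuffled_messages k \<gamma> n D = map_pmf snd (transcript k \<gamma> n D)"

definition z_hat :: "nat \<Rightarrow> 'd message list \<Rightarrow> 'd \<Rightarrow> real" where
  "z_hat k ms l = 1 / real k * (\<Sum>(\<alpha>, y)\<leftarrow>ms. if \<alpha> = l then real y else 0)"

definition debias :: "real \<Rightarrow> nat \<Rightarrow> real \<Rightarrow> real" where
  "debias \<gamma> c z = (z - \<gamma> / 2 * real c) / (1 - \<gamma>)"

definition analyzer :: "nat \<Rightarrow> real \<Rightarrow> 'd::finite message list \<Rightarrow> real ^ 'd" where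
  "analyzer k \<gamma> ms = (\<chi> l. debias \<gamma> (count_list (map fst ms) l) (z_hat k ms l))"

definition sampled_sum :: "nat \<Rightarrow> 'd::finite dataset \<Rightarrow> (nat \<Rightarrow> 'd message) \<Rightarrow> real ^ 'd" where
  "sampled_sum n D r = (\<Sum>i<n. D i $ fst (r i) *\<^sub>R axis (fst (r i)) 1)"

definition squared_error :: "nat \<Rightarrow> real \<Rightarrow> nat \<Rightarrow> 'd::finite dataset \<Rightarrow> real" where
  "squared_error k \<gamma> n D = measure_pmf.expectation (transcript k \<gamma> n D)
     (\<lambda>(r, s). (norm (analyzer k \<gamma> s - sampled_sum n D r))\<^sup>2)"

definition mse :: "'d::finite itself \<Rightarrow> nat \<Rightarrow> real \<Rightarrow> nat \<Rightarrow> real" where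
  "mse _ k \<gamma> n = (SUP D \<in> (datasets n :: 'd dataset set). squared_error k \<gamma> n D)"

definition normalized_mse :: "'d::finite itself \<Rightarrow> nat \<Rightarrow> real \<Rightarrow> nat \<Rightarrow> real" where
  "normalized_mse T k \<gamma> n = mse T k \<gamma> n / (real n / real CARD('d))\<^sup>2"

definition gamma_param :: "nat \<Rightarrow> nat \<Rightarrow> real \<Rightarrow> real \<Rightarrow> nat \<Rightarrow> real" where
  "gamma_param d n \<epsilon> \<delta> k =
     (if \<epsilon> < 1
      then max (14 * real d * real k * ln (2 / \<delta>) / ((real n - 1) * \<epsilon>\<^sup>2))
               (27 * real d * real k / ((real n - 1) * \<epsilon>))
      else max (80 * real d * real k * ln (2 / \<delta>) / ((real n - 1) * \<epsilon>\<^sup>2))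
               (36 * real d * real k / (11 * (real n - 1) * \<epsilon>)))"

text \<open>
  The real-valued supremum in \<open>mse\<close> is a genuine one: its range is nonempty and bounded above,
  and the expectations in it are those of random variables with finite support.
\<close>

lemma datasets_nonempty: "datasets n \<noteq> {}"
proof -
  have "restrict (\<lambda>_. 0) {..<n} \<in> (datasets n :: 'd::finite dataset set)"
    by (auto simp: datasets_def)
  then show ?thesis by blast
qed

lemma set_pmf_randomizer:
  assumes "\<forall>l. x $ l \<in> {0..1}"
  shows "set_pmf (randomizer k \<gamma> x) \<subseteq> UNIV \<times> {0..k}"
proof -
  have A: "nat \<lfloor>x $ l * real k\<rfloor> \<le> k" for l
  proof -
    have "x $ l * real k \<le> 1 * real k"
      using assms by (intro mult_right_mono) simp_all
    then show ?thesis by linarith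
  qed
  have B: "x $ l * real k = real k"
    if "nat \<lfloor>x $ l * real k\<rfloor> = k" for l
  proof -
    have "0 \<le> x $ l * real k" "x $ l * real k \<le> 1 * real k"
      using assms by (simp_all add: mult_left_le_one_le)
    then show ?thesis using that by linarith
  qed
  have C: "nat \<lfloor>x $ l * real k\<rfloor> + of_bool b \<le> k"
    if "b \<in> set_pmf (bernoulli_pmf (x $ l * real k - of_int \<lfloor>x $ l * real k\<rfloor>))" for l b
  proof (cases "nat \<lfloor>x $ l * real k\<rfloor> = k")
    case True
    then have "x $ l * real k - of_int \<lfloor>x $ l * real k\<rfloor> = 0"
      unfolding B[OF True] by simp
    then have "\<not> b" using that by (auto simp: set_pmf_iff)
    then show ?thesis using A[of l] by simp
  next
    case False
    then show ?thesis using A[of l] by (cases b) auto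
  qed
  show ?thesis
    using C by (auto simp: randomizer_def Let_def set_pmf_of_set split: if_splits)
qed

lemma set_pmf_transcript:
  assumes "D \<in> datasets n" "(r, s) \<in> set_pmf (transcript k \<gamma> n D)"
  shows "r \<in> PiE_dflt {..<n} undefined (\<lambda>_. UNIV \<times> {0..k})" "mset s = mset (map r [0..<n])"
proof -
  have "r \<in> PiE_dflt {..<n} undefined (\<lambda>i. set_pmf (randomizer k \<gamma> (D i)))"
    using assms(2) by (auto simp: transcript_def set_Pi_pmf o_def)
  moreover have "set_pmf (randomizer k \<gamma> (D i)) \<subseteq> UNIV \<times> {0..k}" if "i < n" for i
    using assms(1) that by (intro set_pmf_randomizer) (auto simp: datasets_def PiE_iff)
  ultimately show "r \<in> PiE_dflt {..<n} undefined (\<lambda>_. UNIV \<times> {0..k})"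
    by (fastforce simp: PiE_dflt_def)
  have "s \<in> set_pmf (shuffler (map r [0..<n]))"
    using assms(2) by (auto simp: transcript_def)
  then obtain p where "p permutes {..<length (map r [0..<n])}" "s = permute_list p (map r [0..<n])"
    using set_pmf_of_set[OF _ finite_permutations[of "{..<length (map r [0..<n])}"]] permutes_id
    by (fastforce simp: shuffler_def)
  then show "mset s = mset (map r [0..<n])"
    by (metis mset_permute_list)
qed

lemma finite_set_pmf_transcript:
  assumes "D \<in> datasets n"
  shows "finite (set_pmf (transcript k \<gamma> n D :: ((nat \<Rightarrow> 'd::finite message) \<times> _) pmf))"
proof -
  let ?R = "PiE_dflt {..<n} undefined (\<lambda>_. UNIV \<times> {0..k}) :: (nat \<Rightarrow> 'd message) set"
  have "set_pmf (transcript k \<gamma> n D) \<subseteq> (SIGMA r:?R. {s. mset s = mset (map r [0..<n])})"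
    using set_pmf_transcript[OF assms] by auto
  moreover have "finite {s. mset s = mset (map r [0..<n])}" for r :: "nat \<Rightarrow> 'd message"
    using finite_permutations_of_multiset[of "mset (map r [0..<n])"]
    by (simp only: permutations_of_multiset_def)
  moreover have "finite ?R"
    by (intro finite_PiE_dflt) auto
  ultimately show ?thesis
    by (blast intro: finite_subset finite_SigmaI)
qed

lemma norm_sampled_sum_le:
  assumes "D \<in> datasets n"
  shows "norm (sampled_sum n D r) \<le> real n"
proof -
  have "norm (sampled_sum n D r) \<le> (\<Sum>i<n. 1)"
    unfolding sampled_sum_def
    by (rule sum_norm_le) (use assms in \<open>auto simp: datasets_def PiE_iff\<close>)
  then show ?thesis by simp
qed

lemma bdd_above_squared_error: "bdd_above (squared_error k \<gamma> n ` (datasets n :: 'd::finite dataset set))"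
proof -
  let ?R = "PiE_dflt {..<n} undefined (\<lambda>_. UNIV \<times> {0..k}) :: (nat \<Rightarrow> 'd message) set"
  let ?S = "SIGMA r:?R. {s. mset s = mset (map r [0..<n])}"
  have fin: "finite ?S"
  proof (intro finite_SigmaI)
    show "finite ?R" by (intro finite_PiE_dflt) auto
    show "finite {s. mset s = mset (map r [0..<n])}" for r :: "nat \<Rightarrow> 'd message"
      using finite_permutations_of_multiset[of "mset (map r [0..<n])"]
      by (simp only: permutations_of_multiset_def)
  qed
  define B where "B = Max (insert 0 ((\<lambda>(r, s). norm (analyzer k \<gamma> s :: real ^ 'd)) ` ?S))"
  have "squared_error k \<gamma> n D \<le> (B + real n)\<^sup>2" if D: "D \<in> (datasets n :: 'd dataset set)" for D
  proof -
    have ae: "AE x in transcript k \<gamma> n D.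
        (case x of (r, s) \<Rightarrow> (norm (analyzer k \<gamma> s - sampled_sum n D r))\<^sup>2) \<le> (B + real n)\<^sup>2"
    proof (rule AE_pmfI)
      fix x assume x: "x \<in> set_pmf (transcript k \<gamma> n D)"
      obtain r s where xs: "x = (r, s)" by force
      have "(r, s) \<in> ?S"
        using set_pmf_transcript[OF D, of r s k \<gamma>] x xs by auto
      then have "norm (analyzer k \<gamma> s) \<le> B"
        unfolding B_def using fin by (intro Max_ge) force+
      then have "norm (analyzer k \<gamma> s - sampled_sum n D r) \<le> B + real n"
        using norm_sampled_sum_le[OF D, of r] norm_triangle_ineq4[of "analyzer k \<gamma> s" "sampled_sum n D r"]
        by linarith
      then show "(case x of (r, s) \<Rightarrow> (norm (analyzer k \<gamma> s - sampled_sum n D r))\<^sup>2) \<le> (B + real n)\<^sup>2"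
        using xs by (simp add: power_mono)
    qed
    show ?thesis
      unfolding squared_error_def
      by (rule measure_pmf.integral_le_const[OF integrable_measure_pmf_finite ae])
         (rule finite_set_pmf_transcript[OF D])
  qed
  then show ?thesis by (auto simp: bdd_above_def)
qed

end

theory Submission
  imports Defs
begin

text \<open>
  Privacy: by convexity it suffices to compare two fixed messages \<open>v\<close>, \<open>v'\<close> of the user who changes.
  The uniform messages of the other users (the privacy blanket) hide them: the likelihood ratio of
  the two views is \<open>(N + 1) / N'\<close>, where \<open>N\<close> and \<open>N'\<close> count the blanket messages equal to \<open>v\<close> and \<open>v'\<close>.
  A Chernoff bound for \<open>N + 1 - e\<^sup>\<epsilon> N'\<close> shows that this ratio exceeds \<open>e\<^sup>\<epsilon>\<close> with probability at most \<open>\<delta>\<close>.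
  The blanket lives on \<open>d (k + 1)\<close> messages whereas \<open>\<gamma>\<close> is proportional to \<open>d k\<close>, so
  a factor \<open>k / (k + 1) \<ge> 1 / 2\<close> is lost; the constants leave room for it.

  Error: the errors of the users are independent and centred, so the mean squared error is a sum of
  variances, each at most about \<open>1 / (4 k\<^sup>2) + \<gamma> / 3\<close>; since \<open>\<gamma>\<close> is linear in \<open>k\<close>, it remains to balance
  the two terms.
\<close>

section \<open>Finite expectations and the shuffler\<close>

lemma expectation_bind_pmf_finite:
  fixes h :: "'b \<Rightarrow> 'c :: {banach, second_countable_topology}"
  assumes "finite (set_pmf p)" "\<And>x. x \<in> set_pmf p \<Longrightarrow> finite (set_pmf (f x))"
  shows "measure_pmf.expectation (p \<bind> f) h =
    measure_pmf.expectation p (\<lambda>x. measure_pmf.expectation (f x) h)"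
proof -
  have "measure_pmf.expectation (p \<bind> f) h =
      (\<Sum>a\<in>set_pmf p. pmf p a *\<^sub>R measure_pmf.expectation (f a) h)"
    using assms by (intro pmf_expectation_bind) auto
  also have "\<dots> = measure_pmf.expectation p (\<lambda>x. measure_pmf.expectation (f x) h)"
    by (rule integral_measure_pmf[symmetric]) (use assms in auto)
  finally show ?thesis .
qed

lemma expectation_pmf_mono:
  fixes f g :: "'a \<Rightarrow> real"
  assumes "finite (set_pmf p)" "\<And>x. x \<in> set_pmf p \<Longrightarrow> f x \<le> g x"
  shows "measure_pmf.expectation p f \<le> measure_pmf.expectation p g"
  by (rule integral_mono_AE)
     (use assms in \<open>auto intro: integrable_measure_pmf_finite simp: AE_measure_pmf_iff\<close>)

lemma expectation_pmf_add:
  fixes f g :: "'a \<Rightarrow> real"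
  assumes "finite (set_pmf p)"
  shows "measure_pmf.expectation p (\<lambda>x. f x + g x) =
    measure_pmf.expectation p f + measure_pmf.expectation p g"
  by (intro Bochner_Integration.integral_add integrable_measure_pmf_finite assms)

lemma expectation_pmf_sum:
  fixes f :: "'i \<Rightarrow> 'a \<Rightarrow> real"
  assumes "finite (set_pmf p)"
  shows "measure_pmf.expectation p (\<lambda>x. \<Sum>i\<in>A. f i x) = (\<Sum>i\<in>A. measure_pmf.expectation p (f i))"
  by (intro Bochner_Integration.integral_sum integrable_measure_pmf_finite assms)

lemma finite_set_Pi_pmf:
  assumes "finite A" "\<And>i. i \<in> A \<Longrightarrow> finite (set_pmf (Q i))"
  shows "finite (set_pmf (Pi_pmf A dflt Q))"
  using assms by (subst set_Pi_pmf) auto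

text \<open>Conditioning on one independent coordinate. It isolates the user who changes in the
  privacy argument and drives the induction for the second moment of the error.\<close>

lemma expectation_Pi_pmf_insert:
  fixes h :: "('i \<Rightarrow> 'a) \<Rightarrow> 'c :: {banach, second_countable_topology}"
  assumes "finite A" "x \<notin> A" "\<And>i. i \<in> insert x A \<Longrightarrow> finite (set_pmf (Q i))"
  shows "measure_pmf.expectation (Pi_pmf (insert x A) dflt Q) h =
    measure_pmf.expectation (Q x) (\<lambda>y. measure_pmf.expectation (Pi_pmf A dflt Q) (\<lambda>w. h (w(x := y))))"
  using assms
  by (simp add: Pi_pmf_insert' expectation_bind_pmf_finite finite_set_Pi_pmf)

text \<open>Left composition with a fixed permutation is a bijection of the permutation group, so it
  keeps the uniform law. Hence the view of an observer is only the multiset of messages.\<close>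

lemma shuffler_cong_mset:
  assumes "mset xs = mset ys"
  shows "shuffler xs = shuffler ys"
proof -
  obtain q where q: "q permutes {..<length ys}" "permute_list q ys = xs"
    using mset_eq_permutation[OF assms] by metis
  have len: "length xs = length ys" using q by auto
  have bij: "bij_betw (\<lambda>\<pi>. q \<circ> \<pi>) {\<pi>. \<pi> permutes {..<length ys}} {\<pi>. \<pi> permutes {..<length ys}}"
    unfolding bij_betw_def
  proof
    show "inj_on (\<lambda>\<pi>. q \<circ> \<pi>) {\<pi>. \<pi> permutes {..<length ys}}"
      using permutes_inj[OF q(1)] by (auto intro!: inj_onI dest: fun.inj_map_strong[rotated] simp: inj_eq fun_eq_iff)
    show "(\<lambda>\<pi>. q \<circ> \<pi>) ` {\<pi>. \<pi> permutes {..<length ys}} = {\<pi>. \<pi> permutes {..<length ys}}"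
      using image_compose_permutations_left[OF q(1)] by (simp add: setcompr_eq_image)
  qed
  have ne: "{\<pi>. \<pi> permutes {..<length ys}} \<noteq> {}" using q(1) by auto
  have "shuffler ys = map_pmf (\<lambda>\<pi>. permute_list \<pi> ys)
      (map_pmf (\<lambda>\<pi>. q \<circ> \<pi>) (pmf_of_set {\<pi>. \<pi> permutes {..<length ys}}))"
    using map_pmf_of_set_bij_betw[OF bij ne] by (simp add: shuffler_def finite_permutations)
  also have "\<dots> = map_pmf (\<lambda>\<pi>. permute_list \<pi> xs) (pmf_of_set {\<pi>. \<pi> permutes {..<length ys}})"
    unfolding map_pmf_comp
  proof (rule map_pmf_cong)
    fix \<pi> assume "\<pi> \<in> set_pmf (pmf_of_set {\<pi>. \<pi> permutes {..<length ys}})"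
    then have "\<pi> permutes {..<length ys}"
      using ne by (simp add: finite_permutations)
    then show "permute_list (q \<circ> \<pi>) ys = permute_list \<pi> xs"
      using q by (simp add: permute_list_compose)
  qed simp
  finally show ?thesis by (simp add: shuffler_def len)
qed

text \<open>By independence the joint law depends on coordinate \<open>i\<close> only through its
  marginal, which \<open>\<tau>\<close> leaves unchanged.\<close>

lemma Pi_pmf_map_component:
  assumes "finite A" "i \<in> A" "map_pmf \<tau> (Q i) = Q i"
  shows "map_pmf (\<lambda>w. w(i := \<tau> (w i))) (Pi_pmf A dflt Q) = Pi_pmf A dflt Q"
proof -
  define A' where "A' = A - {i}"
  have A: "A = insert i A'" "i \<notin> A'" "finite A'" using assms by (auto simp: A'_def)
  have "Pi_pmf A dflt Q = map_pmf (\<lambda>(y, f). f(i := y)) (pair_pmf (Q i) (Pi_pmf A' dflt Q))"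
    unfolding A(1) using A by (intro Pi_pmf_insert) auto
  moreover have "map_pmf (\<lambda>(y, f). f(i := y)) (pair_pmf (map_pmf \<tau> (Q i)) (Pi_pmf A' dflt Q)) =
      map_pmf (\<lambda>w. w(i := \<tau> (w i))) (map_pmf (\<lambda>(y, f). f(i := y)) (pair_pmf (Q i) (Pi_pmf A' dflt Q)))"
    by (simp add: pair_map_pmf1 map_pmf_comp case_prod_beta' apfst_def map_prod_def)
  ultimately show ?thesis using assms(3) by simp
qed

lemma map_pmf_transpose:
  assumes "pmf p a = pmf p b"
  shows "map_pmf (Transposition.transpose a b) p = p"
proof (rule pmf_eqI)
  fix x
  \<comment> \<open>Transposing twice presents \<open>x\<close> as an image point, so that
    injectivity gives its mass.\<close>
  have "pmf (map_pmf (Transposition.transpose a b) p) x = pmf (map_pmf (Transposition.transpose a b) p) (Transposition.transpose a b (Transposition.transpose a b x))"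
    by simp
  also have "\<dots> = pmf p (Transposition.transpose a b x)"
    by (rule pmf_map_inj') simp
  also have "\<dots> = pmf p x"
    using assms by (auto simp: Transposition.transpose_def)
  finally show "pmf (map_pmf (Transposition.transpose a b) p) x = pmf p x" .
qed

section \<open>The privacy blanket\<close>

text \<open>The Boolean flag tells a blanket message from a data-dependent one. Only flagged copies
  count, because their probability is the same whatever the user's data.\<close>

definition blanket_count :: "'i set \<Rightarrow> 'm \<Rightarrow> ('i \<Rightarrow> bool \<times> 'm) \<Rightarrow> nat" where
  "blanket_count A u w = card {i \<in> A. w i = (True, u)}"

definition messages :: "'i set \<Rightarrow> ('i \<Rightarrow> bool \<times> 'm) \<Rightarrow> 'm multiset" where
  "messages A w = {#snd (w i). i \<in># mset_set A#}"

lemma blanket_count_conv_sum: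
  "finite A \<Longrightarrow> real (blanket_count A u w) = (\<Sum>i\<in>A. of_bool (w i = (True, u)))"
  by (simp add: blanket_count_def sum.If_cases of_bool_def Int_def)

text \<open>
  At a single user, exchanging the blanket messages \<open>(True, v)\<close> and \<open>(True, v')\<close> preserves the joint
  law. If that user sent \<open>v\<close>, the exchange turns \<open>add_mset v'\<close> of the messages into \<open>add_mset v\<close> of the
  exchanged ones. So the likelihood ratio of the two views is \<open>count v' / (count v + 1)\<close>.
\<close>

lemma blanket_exchange:
  fixes Q :: "'i \<Rightarrow> (bool \<times> 'm) pmf" and F :: "'m multiset \<Rightarrow> real"
  assumes A: "finite A" and fin: "\<And>i. i \<in> A \<Longrightarrow> finite (set_pmf (Q i))"
    and "v \<noteq> v'" and eq: "\<And>i. i \<in> A \<Longrightarrow> pmf (Q i) (True, v) = pmf (Q i) (True, v')"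
    and F: "\<And>M. 0 \<le> F M"
  shows "measure_pmf.expectation (Pi_pmf A dflt Q)
      (\<lambda>w. F (add_mset v (messages A w)) * (real (blanket_count A v' w) / (real (blanket_count A v w) + 1)))
    \<le> measure_pmf.expectation (Pi_pmf A dflt Q) (\<lambda>w. F (add_mset v' (messages A w)))"
proof -
  let ?P = "Pi_pmf A dflt Q"
  let ?E = "measure_pmf.expectation ?P :: _ \<Rightarrow> real"
  let ?f = "\<lambda>w. F (add_mset v (messages A w)) * (real (blanket_count A v' w) / (real (blanket_count A v w) + 1))"
  let ?f' = "\<lambda>w. F (add_mset v' (messages A w))"
  have finP: "finite (set_pmf ?P)" by (intro finite_set_Pi_pmf A fin)
  define \<tau> where "\<tau> = Transposition.transpose (True, v) (True, v')"
  define T where "T i w = w(i := \<tau> (w i))" for i and w :: "'i \<Rightarrow> bool \<times> 'm"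
  define g where "g w = F (add_mset v (messages A w)) / (real (blanket_count A v w) + 1)" for w
  define g' where "g' w = F (add_mset v' (messages A w)) / real (blanket_count A v w)" for w
  have inv: "map_pmf (T i) ?P = ?P" if "i \<in> A" for i
    unfolding T_def using that A eq by (intro Pi_pmf_map_component) (auto simp: \<tau>_def map_pmf_transpose)
  have swap: "g (T i w) = g' w" if i: "i \<in> A" and w: "w i = (True, v)" for i w
  proof -
    have T: "T i w i = (True, v')" "\<And>j. j \<noteq> i \<Longrightarrow> T i w j = w j"
      using w by (auto simp: T_def \<tau>_def)
    have "mset_set A = add_mset i (mset_set (A - {i}))"
      using A i by (simp add: mset_set.remove)
    then have "add_mset v (messages A (T i w)) = add_mset v' (messages A w)"
      using w T A by (auto simp: messages_def intro!: image_mset_cong)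
    moreover have "{j \<in> A. w j = (True, v)} = insert i {j \<in> A. T i w j = (True, v)}"
    proof (rule set_eqI)
      fix j
      show "j \<in> {j \<in> A. w j = (True, v)} \<longleftrightarrow> j \<in> insert i {j \<in> A. T i w j = (True, v)}"
        using i w T \<open>v \<noteq> v'\<close> by (cases "j = i") auto
    qed
    then have "blanket_count A v w = Suc (blanket_count A v (T i w))"
      using A T(1) \<open>v \<noteq> v'\<close> by (simp add: blanket_count_def)
    ultimately show ?thesis by (simp add: g_def g'_def add.commute)
  qed
  \<comment> \<open>The count of \<open>v'\<close> is expanded into indicators, the exchange is
    applied to one user at a time, and the resulting indicators are collected into the count of
    \<open>v\<close>.\<close>
  have "?E ?f = ?E (\<lambda>w. \<Sum>i\<in>A. g w * of_bool (w i = (True, v')))"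
  proof -
    have "?f w = g w * real (blanket_count A v' w)" for w by (simp add: g_def)
    then show ?thesis by (simp only: blanket_count_conv_sum[OF A, of v'] sum_distrib_left)
  qed
  also have "\<dots> = (\<Sum>i\<in>A. ?E (\<lambda>w. g w * of_bool (w i = (True, v'))))"
    by (rule expectation_pmf_sum[OF finP])
  also have "\<dots> = (\<Sum>i\<in>A. ?E (\<lambda>w. g' w * of_bool (w i = (True, v))))"
  proof (rule sum.cong[OF refl])
    fix i assume i: "i \<in> A"
    have "?E (\<lambda>w. g w * of_bool (w i = (True, v'))) =
        measure_pmf.expectation (map_pmf (T i) ?P) (\<lambda>w. g w * of_bool (w i = (True, v')))"
      by (simp add: inv[OF i])
    also have "\<dots> = ?E (\<lambda>w. g (T i w) * of_bool (w i = (True, v)))"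
      by (auto intro!: Bochner_Integration.integral_cong simp: T_def \<tau>_def Transposition.transpose_def of_bool_def)
    also have "\<dots> = ?E (\<lambda>w. g' w * of_bool (w i = (True, v)))"
      by (auto intro!: Bochner_Integration.integral_cong simp: swap[OF i] of_bool_def)
    finally show "?E (\<lambda>w. g w * of_bool (w i = (True, v'))) = \<dots>" .
  qed
  also have "\<dots> = ?E (\<lambda>w. g' w * real (blanket_count A v w))"
    by (simp only: expectation_pmf_sum[OF finP] blanket_count_conv_sum[OF A, of v] sum_distrib_left)
  \<comment> \<open>The integrands agree unless no blanket message equals \<open>v\<close>; then the
    left one is 0 and \<open>F \<ge> 0\<close> gives the inequality.\<close>
  also have "\<dots> \<le> ?E ?f'"
    by (intro expectation_pmf_mono finP) (simp add: g'_def F)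
  finally show ?thesis .
qed

text \<open>Exponential Markov inequality: the indicator of \<open>N + 1 - r * N' > 0\<close> is at
  most \<open>exp (t * (N + 1 - r * N'))\<close>, which factors over the independent users. The
  summand 1 produces the leading \<open>t\<close> of the exponent.\<close>

lemma blanket_chernoff:
  fixes Q :: "'i \<Rightarrow> (bool \<times> 'm) pmf"
  assumes A: "finite A" and fin: "\<And>i. i \<in> A \<Longrightarrow> finite (set_pmf (Q i))"
    and "v \<noteq> v'" and p: "\<And>i. i \<in> A \<Longrightarrow> pmf (Q i) (True, v) = p"
    and p': "\<And>i. i \<in> A \<Longrightarrow> pmf (Q i) (True, v') = p" and "0 \<le> t"
  shows "measure_pmf.expectation (Pi_pmf A dflt Q)
      (\<lambda>w. of_bool (r * real (blanket_count A v' w) < real (blanket_count A v w) + 1))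
    \<le> exp (t + real (card A) * p * (exp t + exp (- t * r) - 2))"
proof -
  let ?P = "Pi_pmf A dflt Q"
  let ?E = "measure_pmf.expectation ?P :: _ \<Rightarrow> real"
  let ?bad = "\<lambda>w. of_bool (r * real (blanket_count A v' w) < real (blanket_count A v w) + 1) :: real"
  have finP: "finite (set_pmf ?P)" by (intro finite_set_Pi_pmf A fin)
  define f :: "bool \<times> 'm \<Rightarrow> real"
    where "f x = exp (t * (of_bool (x = (True, v)) - r * of_bool (x = (True, v'))))" for x
  have f_pos: "0 \<le> f x" for x by (simp add: f_def)
  \<comment> \<open>Since \<open>v \<noteq> v'\<close>, the two events are disjoint and
    \<open>f\<close> is affine in their indicators.\<close>
  have f_alt: "f x = 1 + ((exp t - 1) * indicator {(True, v)} x + (exp (- t * r) - 1) * indicator {(True, v')} x)" for x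
    using \<open>v \<noteq> v'\<close> by (auto simp: f_def indicator_def)
  have Ef: "measure_pmf.expectation (Q i) f \<le> exp (p * (exp t + exp (- t * r) - 2))" if i: "i \<in> A" for i
  proof -
    have "measure_pmf.expectation (Q i) f = 1 + ((exp t - 1) * p + (exp (- t * r) - 1) * p)"
      unfolding f_alt using p[OF i] p'[OF i]
      by (simp add: expectation_pmf_add[OF fin[OF i]] measure_pmf_single)
    also have "\<dots> = 1 + p * (exp t + exp (- t * r) - 2)" by (simp add: algebra_simps)
    also have "\<dots> \<le> exp (p * (exp t + exp (- t * r) - 2))" by (rule exp_ge_add_one_self)
    finally show ?thesis .
  qed
  have "?E ?bad \<le> ?E (\<lambda>w. exp t * (\<Prod>i\<in>A. f (w i)))"
  proof (intro expectation_pmf_mono finP)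
    fix w
    have "exp t * (\<Prod>i\<in>A. f (w i)) = exp (t * (real (blanket_count A v w) + 1 - r * real (blanket_count A v' w)))"
      unfolding f_def exp_sum[OF A, symmetric] exp_add[symmetric]
      using A by (simp add: blanket_count_conv_sum sum_distrib_left[symmetric] sum_subtractf algebra_simps)
    moreover have "?bad w \<le> exp (t * (real (blanket_count A v w) + 1 - r * real (blanket_count A v' w)))"
      using \<open>0 \<le> t\<close> by (auto simp: of_bool_def)
    ultimately show "?bad w \<le> exp t * (\<Prod>i\<in>A. f (w i))" by simp
  qed
  also have "\<dots> = exp t * (\<Prod>i\<in>A. measure_pmf.expectation (Q i) f)"
    using A fin by (subst expectation_prod_Pi_pmf[where f = "\<lambda>_. f", symmetric])
      (auto intro: integrable_measure_pmf_finite simp: f_pos)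
  also have "\<dots> \<le> exp t * (\<Prod>i\<in>A. exp (p * (exp t + exp (- t * r) - 2)))"
    by (intro mult_left_mono prod_mono conjI Ef Bochner_Integration.integral_nonneg) (auto simp: f_def)
  also have "\<dots> = exp (t + real (card A) * p * (exp t + exp (- t * r) - 2))"
    by (simp add: exp_add exp_of_nat_mult[symmetric] mult.assoc)
  finally show ?thesis .
qed

text \<open>Where \<open>N + 1 \<le> r * N'\<close> the integrand is dominated by \<open>r\<close>
  times the one of the exchange inequality; elsewhere \<open>F \<le> 1\<close> and the Chernoff
  bound limits the probability. Equal messages are treated apart, since the exchange acts on
  distinct ones. \<open>F\<close> stands for the probability of an event given the multiset of
  messages.\<close>

lemma blanket_amplification:
  fixes Q :: "'i \<Rightarrow> (bool \<times> 'm) pmf" and F :: "'m multiset \<Rightarrow> real"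
  assumes A: "finite A" and fin: "\<And>i. i \<in> A \<Longrightarrow> finite (set_pmf (Q i))"
    and p: "\<And>i. i \<in> A \<Longrightarrow> pmf (Q i) (True, v) = p"
    and p': "\<And>i. i \<in> A \<Longrightarrow> pmf (Q i) (True, v') = p"
    and F: "\<And>M. 0 \<le> F M" "\<And>M. F M \<le> 1" and "0 \<le> t" "1 \<le> r"
  shows "measure_pmf.expectation (Pi_pmf A dflt Q) (\<lambda>w. F (add_mset v (messages A w)))
    \<le> r * measure_pmf.expectation (Pi_pmf A dflt Q) (\<lambda>w. F (add_mset v' (messages A w)))
      + exp (t + real (card A) * p * (exp t + exp (- t * r) - 2))"
proof (cases "v = v'")
  case True
  let ?E = "measure_pmf.expectation (Pi_pmf A dflt Q) :: _ \<Rightarrow> real"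
  let ?f' = "\<lambda>w. F (add_mset v' (messages A w))"
  have "0 \<le> ?E ?f'" using F(1) by (intro Bochner_Integration.integral_nonneg) auto
  then have "?E ?f' \<le> r * ?E ?f'" using \<open>1 \<le> r\<close> by (simp add: mult_le_cancel_right1)
  then show ?thesis using True by (simp add: add_increasing2)
next
  case False
  let ?P = "Pi_pmf A dflt Q"
  let ?E = "measure_pmf.expectation ?P :: _ \<Rightarrow> real"
  let ?f = "\<lambda>w. F (add_mset v (messages A w))" and ?f' = "\<lambda>w. F (add_mset v' (messages A w))"
  let ?\<delta> = "exp (t + real (card A) * p * (exp t + exp (- t * r) - 2))"
  have finP: "finite (set_pmf ?P)" by (intro finite_set_Pi_pmf A fin)
  let ?N = "\<lambda>w. real (blanket_count A v w)" and ?N' = "\<lambda>w. real (blanket_count A v' w)"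
  have "?E ?f \<le> ?E (\<lambda>w. r * (?f w * (?N' w / (?N w + 1))) + of_bool (r * ?N' w < ?N w + 1))"
  proof (intro expectation_pmf_mono finP)
    fix w
    have "0 \<le> r * (?f w * (?N' w / (?N w + 1)))" using F(1) \<open>1 \<le> r\<close> by simp
    moreover have "?f w \<le> r * (?f w * (?N' w / (?N w + 1)))" if "\<not> r * ?N' w < ?N w + 1"
    proof -
      have "?f w * 1 \<le> ?f w * (r * ?N' w / (?N w + 1))"
        using that F(1) by (intro mult_left_mono) auto
      then show ?thesis by (simp add: mult_ac)
    qed
    ultimately show "?f w \<le> r * (?f w * (?N' w / (?N w + 1))) + of_bool (r * ?N' w < ?N w + 1)"
      using F(2)[of "add_mset v (messages A w)"] by (auto simp: of_bool_def)
  qed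
  also have "\<dots> = r * ?E (\<lambda>w. ?f w * (?N' w / (?N w + 1))) + ?E (\<lambda>w. of_bool (r * ?N' w < ?N w + 1))"
    by (simp only: expectation_pmf_add[OF finP] integral_mult_right_zero)
  also have "\<dots> \<le> r * ?E ?f' + ?\<delta>"
  proof (intro add_mono mult_left_mono)
    show "?E (\<lambda>w. ?f w * (?N' w / (?N w + 1))) \<le> ?E ?f'"
      by (rule blanket_exchange) (use A fin p p' F False in auto)
    show "?E (\<lambda>w. of_bool (r * ?N' w < ?N w + 1)) \<le> ?\<delta>"
      by (rule blanket_chernoff) (use A fin p p' False \<open>0 \<le> t\<close> in auto)
  qed (use \<open>1 \<le> r\<close> in auto)
  finally show ?thesis .
qed

section \<open>The law of the randomizer\<close>

text \<open>The blanket bit is exposed for the analysis only; neither shuffler nor analyzer sees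
  it.\<close>

definition flagged_randomizer :: "nat \<Rightarrow> real \<Rightarrow> real ^ 'd::finite \<Rightarrow> (bool \<times> 'd message) pmf" where
  "flagged_randomizer k \<gamma> x = do {
     \<alpha> \<leftarrow> pmf_of_set UNIV;
     b \<leftarrow> bernoulli_pmf (x $ \<alpha> * real k - of_int \<lfloor>x $ \<alpha> * real k\<rfloor>);
     blanket \<leftarrow> bernoulli_pmf \<gamma>;
     y \<leftarrow> (if blanket then pmf_of_set {0..k} else return_pmf (nat \<lfloor>x $ \<alpha> * real k\<rfloor> + of_bool b));
     return_pmf (blanket, (\<alpha>, y))
   }"

lemma map_snd_flagged_randomizer: "map_pmf snd (flagged_randomizer k \<gamma> x) = randomizer k \<gamma> x"
  by (simp add: flagged_randomizer_def randomizer_def Let_def map_bind_pmf)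

lemma finite_set_flagged_randomizer: "finite (set_pmf (flagged_randomizer k \<gamma> x))"
  by (auto simp: flagged_randomizer_def set_pmf_of_set split: if_splits)

lemma finite_set_randomizer: "finite (set_pmf (randomizer k \<gamma> x))"
  by (simp add: map_snd_flagged_randomizer[symmetric] finite_set_flagged_randomizer)

text \<open>The closed form behind all later computations: the blanket probabilities and the first
  two moments of the error arise by substituting for \<open>h\<close>.\<close>

lemma expectation_flagged_randomizer:
  fixes h :: "bool \<times> 'd::finite message \<Rightarrow> real"
  assumes "0 \<le> \<gamma>" "\<gamma> \<le> 1"
  shows "measure_pmf.expectation (flagged_randomizer k \<gamma> x) h =
    (\<Sum>\<alpha>\<in>UNIV. \<gamma> * (\<Sum>y\<le>k. h (True, (\<alpha>, y))) / (real k + 1) +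
      (1 - \<gamma>) * (frac (x $ \<alpha> * real k) * h (False, (\<alpha>, nat \<lfloor>x $ \<alpha> * real k\<rfloor> + 1)) +
        (1 - frac (x $ \<alpha> * real k)) * h (False, (\<alpha>, nat \<lfloor>x $ \<alpha> * real k\<rfloor>)))) / real CARD('d)"
proof -
  have f: "0 \<le> x $ \<alpha> * real k - of_int \<lfloor>x $ \<alpha> * real k\<rfloor>" "x $ \<alpha> * real k - of_int \<lfloor>x $ \<alpha> * real k\<rfloor> \<le> 1" for \<alpha>
    by linarith+
  have U: "measure_pmf.expectation (pmf_of_set {0..k}) (\<lambda>y. h (True, (\<alpha>, y))) = (\<Sum>y\<le>k. h (True, (\<alpha>, y))) / (real k + 1)" for \<alpha>
    by (simp add: integral_pmf_of_set atLeast0AtMost add.commute)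
  define R :: "'d \<Rightarrow> (bool \<times> 'd message) pmf" where "R \<alpha> = do {
     b \<leftarrow> bernoulli_pmf (x $ \<alpha> * real k - of_int \<lfloor>x $ \<alpha> * real k\<rfloor>);
     blanket \<leftarrow> bernoulli_pmf \<gamma>;
     y \<leftarrow> (if blanket then pmf_of_set {0..k} else return_pmf (nat \<lfloor>x $ \<alpha> * real k\<rfloor> + of_bool b));
     return_pmf (blanket, (\<alpha>, y))
   }" for \<alpha>
  have fin: "finite (set_pmf (R \<alpha>))" for \<alpha>
    by (auto simp: R_def set_pmf_of_set split: if_splits)
  have R: "measure_pmf.expectation (R \<alpha>) h = \<gamma> * (\<Sum>y\<le>k. h (True, (\<alpha>, y))) / (real k + 1) +
      (1 - \<gamma>) * (frac (x $ \<alpha> * real k) * h (False, (\<alpha>, nat \<lfloor>x $ \<alpha> * real k\<rfloor> + 1)) +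
        (1 - frac (x $ \<alpha> * real k)) * h (False, (\<alpha>, nat \<lfloor>x $ \<alpha> * real k\<rfloor>)))" for \<alpha>
    by (simp add: R_def expectation_bind_pmf_finite if_distrib[of set_pmf] if_distribR U assms f frac_def cong: if_cong)
       (simp add: algebra_simps add_divide_distrib diff_divide_distrib)
  have "measure_pmf.expectation (flagged_randomizer k \<gamma> x) h = measure_pmf.expectation (pmf_of_set UNIV \<bind> R) h"
    by (simp add: flagged_randomizer_def R_def[abs_def])
  also have "\<dots> = (\<Sum>\<alpha>\<in>UNIV. measure_pmf.expectation (R \<alpha>) h) / real CARD('d)"
    by (simp add: expectation_bind_pmf_finite integral_pmf_of_set fin)
  finally show ?thesis by (simp only: R)
qed

text \<open>The value depends neither on \<open>x\<close> nor on the choice of \<open>v\<close>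
  within the range; this uniformity is what the exchange and the Chernoff bound require.\<close>

lemma pmf_flagged_randomizer_blanket:
  fixes x :: "real ^ 'd::finite"
  assumes "0 \<le> \<gamma>" "\<gamma> \<le> 1" "snd v \<le> k"
  shows "pmf (flagged_randomizer k \<gamma> x) (True, v) = \<gamma> / (real CARD('d) * (real k + 1))"
proof -
  have "pmf (flagged_randomizer k \<gamma> x) (True, v) =
      measure_pmf.expectation (flagged_randomizer k \<gamma> x) (indicator {(True, v)})"
    by (simp add: measure_pmf_single)
  also have "\<dots> = (\<Sum>\<alpha>\<in>UNIV. \<gamma> * (\<Sum>y\<le>k. indicator {(True, v)} (True, (\<alpha>, y))) / (real k + 1)) / real CARD('d)"
    by (subst expectation_flagged_randomizer[OF assms(1,2)]) simp
  also have "\<dots> = (\<Sum>\<alpha>\<in>UNIV. if \<alpha> = fst v then \<gamma> / (real k + 1) else 0) / real CARD('d)"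
  proof (intro arg_cong2[of _ _ _ _ "(/)"] sum.cong refl)
    fix \<alpha>
    have "(\<Sum>y\<le>k. indicator {(True, v)} (True, (\<alpha>, y)) :: real) = (\<Sum>y\<le>k. if y = snd v then of_bool (\<alpha> = fst v) else 0)"
      by (intro sum.cong) (auto simp: indicator_def prod_eq_iff)
    also have "\<dots> = of_bool (\<alpha> = fst v)" using assms(3) by simp
    finally show "\<gamma> * (\<Sum>y\<le>k. indicator {(True, v)} (True, (\<alpha>, y))) / (real k + 1) =
        (if \<alpha> = fst v then \<gamma> / (real k + 1) else 0)" by simp
  qed
  also have "\<dots> = \<gamma> / (real CARD('d) * (real k + 1))" by (simp add: field_simps)
  finally show ?thesis .
qed

section \<open>Reduction of the shuffled output to the blanket\<close>

lemma finite_set_shuffler: "finite (set_pmf (shuffler ms))"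
proof -
  have "{\<pi>. \<pi> permutes {..<length ms}} \<noteq> {}" using permutes_id by blast
  then show ?thesis by (simp add: shuffler_def finite_permutations)
qed

lemma prob_shuffled_messages:
  "measure_pmf.prob (shuffled_messages k \<gamma> n D) E =
    measure_pmf.expectation (Pi_pmf {..<n} undefined (\<lambda>i. randomizer k \<gamma> (D i)))
      (\<lambda>r. measure_pmf.prob (shuffler (map r [0..<n])) E)"
proof -
  have "shuffled_messages k \<gamma> n D =
      Pi_pmf {..<n} undefined (\<lambda>i. randomizer k \<gamma> (D i)) \<bind> (\<lambda>r. shuffler (map r [0..<n]))"
    by (simp add: shuffled_messages_def transcript_def map_bind_pmf bind_return_pmf')
  then have "measure_pmf.expectation (shuffled_messages k \<gamma> n D) (indicator E :: _ \<Rightarrow> real) =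
    measure_pmf.expectation (Pi_pmf {..<n} undefined (\<lambda>i. randomizer k \<gamma> (D i)))
      (\<lambda>r. measure_pmf.expectation (shuffler (map r [0..<n])) (indicator E))"
    by (simp only: expectation_bind_pmf_finite finite_set_Pi_pmf finite_set_randomizer finite_set_shuffler finite_lessThan)
  then show ?thesis by simp
qed

text \<open>Averaging first over \<open>y\<close>, then over \<open>x\<close>. This is the convexity
  that reduces two random messages to two fixed ones.\<close>

lemma expectation_le_of_pointwise_le:
  fixes G :: "'a \<Rightarrow> real"
  assumes fin: "finite (set_pmf p)" "finite (set_pmf q)"
    and le: "\<And>x y. x \<in> set_pmf p \<Longrightarrow> y \<in> set_pmf q \<Longrightarrow> G x \<le> r * G y + c"
  shows "measure_pmf.expectation p G \<le> r * measure_pmf.expectation q G + c"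
proof -
  have "G x \<le> r * measure_pmf.expectation q G + c" if x: "x \<in> set_pmf p" for x
  proof -
    have "measure_pmf.expectation q (\<lambda>_. G x) \<le> measure_pmf.expectation q (\<lambda>y. r * G y + c)"
      by (intro expectation_pmf_mono fin le x)
    then show ?thesis by (simp add: expectation_pmf_add[OF fin(2)])
  qed
  then have "measure_pmf.expectation p G \<le> measure_pmf.expectation p (\<lambda>_. r * measure_pmf.expectation q G + c)"
    by (intro expectation_pmf_mono fin)
  then show ?thesis by simp
qed

text \<open>Conditioned on the message \<open>v\<close> of the user \<open>j\<close> who changes,
  the event has the same probability \<open>G v\<close> under both datasets; these differ only in
  the law of \<open>v\<close>. It remains to compare \<open>G\<close> at two messages and to
  average.\<close>

lemma shuffled_messages_blanket_bound:
  fixes D D' :: "'d::finite dataset"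
  assumes neigh: "neighbouring n D D'" and \<gamma>: "0 \<le> \<gamma>" "\<gamma> \<le> 1" and "0 \<le> t" "1 \<le> r"
  shows "measure_pmf.prob (shuffled_messages k \<gamma> n D) E \<le> r * measure_pmf.prob (shuffled_messages k \<gamma> n D') E
    + exp (t + (real n - 1) * (\<gamma> / (real CARD('d) * (real k + 1))) * (exp t + exp (- t * r) - 2))"
    (is "_ \<le> _ + ?\<delta>")
proof -
  obtain j where j: "j < n" "\<And>i. i < n \<Longrightarrow> i \<noteq> j \<Longrightarrow> D i = D' i"
    and D: "D \<in> datasets n" "D' \<in> datasets n"
    using neigh by (auto simp: neighbouring_def)
  define A where "A = {..<n} - {j}"
  have A: "{..<n} = insert j A" "j \<notin> A" "finite A" "real (card A) = real n - 1"
    using j(1) by (auto simp: A_def)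
  \<comment> \<open>Any list with the given multiset may be chosen, since the shuffler forgets the
    order.\<close>
  define F :: "'d message multiset \<Rightarrow> real"
    where "F M = measure_pmf.prob (shuffler (SOME xs. mset xs = M)) E" for M
  have F: "measure_pmf.prob (shuffler xs) E = F (mset xs)" for xs
  proof -
    have "mset (SOME ys. mset ys = mset xs) = mset xs" by (rule someI) (rule refl)
    from shuffler_cong_mset[OF this] show ?thesis by (simp add: F_def)
  qed
  define Q where "Q i = flagged_randomizer k \<gamma> (D i)" for i
  \<comment> \<open>The default is a pair so that \<open>snd\<close> maps it to the default
    \<open>undefined\<close> of the protocol.\<close>
  let ?P = "Pi_pmf A (undefined, undefined) Q"
  define G where "G v = measure_pmf.expectation ?P (\<lambda>w. F (add_mset v (messages A w)))" for v
  have prob: "measure_pmf.prob (shuffled_messages k \<gamma> n D\<^sub>0) E = measure_pmf.expectation (randomizer k \<gamma> (D\<^sub>0 j)) G"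
    if D\<^sub>0: "\<And>i. i \<in> A \<Longrightarrow> D\<^sub>0 i = D i" for D\<^sub>0
  proof -
    have others: "Pi_pmf A undefined (\<lambda>i. randomizer k \<gamma> (D\<^sub>0 i)) = map_pmf (\<lambda>h. snd \<circ> h) ?P"
      using Pi_pmf_map[OF A(3), of snd "(undefined, undefined)" undefined Q]
      by (simp add: Q_def map_snd_flagged_randomizer D\<^sub>0 cong: Pi_pmf_cong)
    have mset: "mset (map ((snd \<circ> w)(j := v)) [0..<n]) = add_mset v (messages A w)" for w :: "nat \<Rightarrow> bool \<times> 'd message" and v
    proof -
      have "mset [0..<n] = add_mset j (mset_set A)"
        using A by (metis mset_upt atLeast0LessThan mset_set.insert)
      then have "mset (map ((snd \<circ> w)(j := v)) [0..<n]) = add_mset v (image_mset ((snd \<circ> w)(j := v)) (mset_set A))"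
        by (simp only: mset_map image_mset_add_mset fun_upd_same)
      also have "image_mset ((snd \<circ> w)(j := v)) (mset_set A) = messages A w"
        unfolding messages_def using A(2,3) by (intro image_mset_cong) auto
      finally show ?thesis .
    qed
    have "measure_pmf.prob (shuffled_messages k \<gamma> n D\<^sub>0) E =
        measure_pmf.expectation (Pi_pmf (insert j A) undefined (\<lambda>i. randomizer k \<gamma> (D\<^sub>0 i))) (\<lambda>r. F (mset (map r [0..<n])))"
      unfolding prob_shuffled_messages A(1) F ..
    also have "\<dots> = measure_pmf.expectation (randomizer k \<gamma> (D\<^sub>0 j))
        (\<lambda>v. measure_pmf.expectation (Pi_pmf A undefined (\<lambda>i. randomizer k \<gamma> (D\<^sub>0 i))) (\<lambda>r. F (mset (map (r(j := v)) [0..<n]))))"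
      by (rule expectation_Pi_pmf_insert) (use A in \<open>auto simp: finite_set_randomizer\<close>)
    also have "\<dots> = measure_pmf.expectation (randomizer k \<gamma> (D\<^sub>0 j)) G"
      unfolding others integral_map_pmf mset G_def[abs_def] ..
    finally show ?thesis .
  qed
  have G: "G v \<le> r * G v' + ?\<delta>" if "snd v \<le> k" "snd v' \<le> k" for v v'
    unfolding G_def A(4)[symmetric]
    by (rule blanket_amplification)
       (use that A \<gamma> \<open>0 \<le> t\<close> \<open>1 \<le> r\<close> in \<open>auto simp: Q_def finite_set_flagged_randomizer pmf_flagged_randomizer_blanket F_def\<close>)
  \<comment> \<open>Only messages with value at most \<open>k\<close> are covered by the blanket, so
    the support has to stay in that range.\<close>
  have supp: "snd v \<le> k" if "v \<in> set_pmf (randomizer k \<gamma> (D\<^sub>0 j))" "D\<^sub>0 \<in> datasets n" for v and D\<^sub>0 :: "'d dataset"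
  proof -
    have "\<forall>l. D\<^sub>0 j $ l \<in> {0..1}" using that j(1) by (auto simp: datasets_def PiE_iff)
    from set_pmf_randomizer[OF this, of k \<gamma>] that show ?thesis by auto
  qed
  have D'_eq: "D' i = D i" if "i \<in> A" for i
    using j(2) that by (simp add: A_def)
  have "measure_pmf.expectation (randomizer k \<gamma> (D j)) G \<le> r * measure_pmf.expectation (randomizer k \<gamma> (D' j)) G + ?\<delta>"
    by (rule expectation_le_of_pointwise_le) (use G supp D in \<open>auto intro: finite_set_randomizer\<close>)
  then show ?thesis
    by (simp only: prob[OF refl] prob[OF D'_eq])
qed

section \<open>The Chernoff rate\<close>

text \<open>The Lagrange remainder carries \<open>exp u / 2\<close> with
  \<open>exp u \<le> exp (1 / 4) \<le> 4 / 3\<close>, whence the constant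
  \<open>2 / 3\<close>.\<close>

lemma exp_le_quadratic:
  fixes t :: real
  assumes "0 \<le> t" "t \<le> 1 / 4"
  shows "exp t \<le> 1 + t + 2 / 3 * t\<^sup>2"
proof -
  obtain u where u: "\<bar>u\<bar> \<le> \<bar>t\<bar>" "exp t = (\<Sum>m<2. t ^ m / fact m) + exp u / fact 2 * t ^ 2"
    using Maclaurin_exp_le by blast
  have "exp u \<le> exp (1 / 4)" using u(1) assms by simp
  also have "exp (1 / 4 :: real) \<le> 4 / 3"
    using exp_bound[of "1 / 4"] by (simp add: power2_eq_square)
  finally have "exp u / fact 2 * t ^ 2 \<le> 2 / 3 * t ^ 2"
    by (intro mult_right_mono) auto
  then show ?thesis using u(2) by (simp add: eval_nat_numeral)
qed

text \<open>The cubic Lagrange remainder at \<open>- s\<close> is nonpositive.\<close>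

lemma exp_minus_le_quadratic:
  fixes s :: real
  assumes "0 \<le> s"
  shows "exp (- s) \<le> 1 - s + s\<^sup>2 / 2"
proof -
  obtain u where u: "exp (- s) = (\<Sum>m<3. (- s) ^ m / fact m) + exp u / fact 3 * (- s) ^ 3"
    using Maclaurin_exp_le by blast
  have "exp u / fact 3 * (- s) ^ 3 \<le> 0"
    using assms by (simp add: power3_eq_cube)
  then show ?thesis using u by (simp add: eval_nat_numeral)
qed

text \<open>The reciprocal of the Taylor lower bound for \<open>exp s\<close>. It stays useful for
  large \<open>s\<close>, where the quadratic bound exceeds 1.\<close>

lemma exp_minus_le_inverse_quadratic:
  fixes s :: real
  assumes "0 \<le> s"
  shows "exp (- s) \<le> 1 / (1 + s + s\<^sup>2 / 2)"
proof -
  have "0 < 1 + s + s\<^sup>2 / 2" using assms by (intro add_pos_nonneg) auto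
  then have "inverse (exp s) \<le> inverse (1 + s + s\<^sup>2 / 2)"
    using exp_lower_Taylor_quadratic[OF assms] by (intro le_imp_inverse_le)
  then show ?thesis by (simp add: exp_minus inverse_eq_divide)
qed

text \<open>With \<open>t = \<epsilon> / 5\<close> the terms linear in \<epsilon> cancel, and the
  remaining factor of \<open>\<epsilon>\<^sup>2\<close> is bounded below by
  \<open>1 / 7\<close>.\<close>

lemma chernoff_rate_small:
  fixes \<epsilon> :: real
  assumes "0 < \<epsilon>" "\<epsilon> < 1"
  shows "\<epsilon>\<^sup>2 / 7 \<le> 2 - exp (\<epsilon> / 5) - exp (- (\<epsilon> / 5) * exp \<epsilon>)"
proof -
  define r where "r = 1 + \<epsilon> + \<epsilon>\<^sup>2 / 2"
  have r: "0 < r" "r \<le> exp \<epsilon>"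
    using assms exp_lower_Taylor_quadratic[of \<epsilon>] by (auto simp: r_def intro!: add_pos_nonneg)
  have "- (\<epsilon> / 5) * exp \<epsilon> \<le> - (\<epsilon> / 5 * r)" using r assms by simp
  then have "exp (- (\<epsilon> / 5) * exp \<epsilon>) \<le> exp (- (\<epsilon> / 5 * r))" by simp
  also have "\<dots> \<le> 1 - \<epsilon> / 5 * r + (\<epsilon> / 5 * r)\<^sup>2 / 2"
    using r assms by (intro exp_minus_le_quadratic) auto
  finally have 1: "exp (- (\<epsilon> / 5) * exp \<epsilon>) \<le> 1 - \<epsilon> / 5 * r + (\<epsilon> / 5 * r)\<^sup>2 / 2" .
  have 2: "exp (\<epsilon> / 5) \<le> 1 + \<epsilon> / 5 + 2 / 3 * (\<epsilon> / 5)\<^sup>2"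
    using assms by (intro exp_le_quadratic) auto
  have "\<epsilon>\<^sup>2 \<le> \<epsilon>" using assms by (simp add: power2_eq_square mult_left_le)
  then have "r \<le> 1 + 3 / 2 * \<epsilon>" by (simp add: r_def)
  then have "r\<^sup>2 \<le> (1 + 3 / 2 * \<epsilon>)\<^sup>2" using r by (intro power_mono) auto
  also have "\<dots> \<le> 1 + 21 / 4 * \<epsilon>" using \<open>\<epsilon>\<^sup>2 \<le> \<epsilon>\<close> by (simp add: power2_eq_square algebra_simps)
  \<comment> \<open>The constants leave 1/5 - 1/50 - 2/75 = 23/150; the coefficients 1/10 and 21/200
    of \<epsilon> nearly cancel and cost at most 1/200.\<close>
  finally have "1 / 7 \<le> 1 / 5 * (1 + \<epsilon> / 2) - 1 / 50 * r\<^sup>2 - 2 / 75" using assms by (simp add: field_simps)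
  then have "\<epsilon>\<^sup>2 * (1 / 7) \<le> \<epsilon>\<^sup>2 * (1 / 5 * (1 + \<epsilon> / 2) - 1 / 50 * r\<^sup>2 - 2 / 75)"
    by (intro mult_left_mono) auto
  also have "\<dots> = 2 - (1 + \<epsilon> / 5 + 2 / 3 * (\<epsilon> / 5)\<^sup>2) - (1 - \<epsilon> / 5 * r + (\<epsilon> / 5 * r)\<^sup>2 / 2)"
    by (simp add: r_def power2_eq_square field_simps)
  finally show ?thesis using 1 2 by linarith
qed

text \<open>Here \<open>13 / 8 = 1 + 1 / 2 + 1 / 8\<close> is a lower bound for \<open>exp (1 / 2)\<close>.\<close>

lemma chernoff_rate_step:
  fixes \<epsilon> t :: real
  assumes "0 \<le> t" "t \<le> 1 / 4" "real m / 2 \<le> \<epsilon>" "(13 / 8) ^ m \<ge> q" "0 \<le> q"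
  shows "1 - t - 2 / 3 * t\<^sup>2 - 1 / (1 + t * q + (t * q)\<^sup>2 / 2) \<le> 2 - exp t - exp (- t * exp \<epsilon>)"
proof -
  have "q \<le> exp (1 / 2) ^ m"
    using exp_lower_Taylor_quadratic[of "1 / 2"] power_mono[of "13 / 8" "exp (1 / 2) :: real" m] assms(4)
    by (simp add: power2_eq_square)
  also have "\<dots> = exp (real m / 2)" by (simp add: exp_of_nat_mult[symmetric])
  also have "\<dots> \<le> exp \<epsilon>" using assms(3) by simp
  finally have "exp (- t * exp \<epsilon>) \<le> exp (- (t * q))" using assms(1) by (simp add: mult_left_mono)
  also have "\<dots> \<le> 1 / (1 + t * q + (t * q)\<^sup>2 / 2)"
    using assms by (intro exp_minus_le_inverse_quadratic) auto
  finally show ?thesis using exp_le_quadratic[OF assms(1,2)] by linarith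
qed

text \<open>One fixed \<open>t\<close> serves each range of \<epsilon>:
  \<open>exp \<epsilon>\<close> is bounded below at the left end, by some \<open>q\<close> below
  \<open>(13 / 8) ^ m\<close>, and \<open>\<epsilon>\<^sup>2\<close> above at the right end. Larger
  \<epsilon> calls for smaller \<open>t\<close>.\<close>

lemma chernoff_rate_large:
  fixes \<epsilon> :: real
  assumes "1 \<le> \<epsilon>" "\<epsilon> < 6"
  obtains t where "0 \<le> t" "t \<le> 1 / 4" "\<epsilon>\<^sup>2 / 40 \<le> 2 - exp t - exp (- t * exp \<epsilon>)"
proof -
  have sq: "\<epsilon>\<^sup>2 \<le> c\<^sup>2" if "\<epsilon> \<le> c" for c using that assms(1) by (intro power_mono) auto
  consider "\<epsilon> \<le> 2" | "2 \<le> \<epsilon>" "\<epsilon> \<le> 4" | "4 \<le> \<epsilon>" "\<epsilon> \<le> 5" | "5 \<le> \<epsilon>" by linarith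
  then show ?thesis
  proof cases
    case 1
    show ?thesis using chernoff_rate_step[of "1/4" 2 \<epsilon> "5/2"] assms sq[OF 1]
      by (intro that[of "1/4"]) (auto simp: power2_eq_square)
  next
    case 2
    show ?thesis using chernoff_rate_step[of "24/100" 4 \<epsilon> "25/4"] 2 sq[of 4]
      by (intro that[of "24/100"]) (auto simp: power2_eq_square eval_nat_numeral)
  next
    case 3
    show ?thesis using chernoff_rate_step[of "1/10" 8 \<epsilon> 39] 3 sq[of 5]
      by (intro that[of "1/10"]) (auto simp: power2_eq_square eval_nat_numeral)
  next
    case 4
    show ?thesis using chernoff_rate_step[of "1/20" 10 \<epsilon> 128] 4 sq[of 6] assms
      by (intro that[of "1/20"]) (auto simp: power2_eq_square eval_nat_numeral)
  qed
qed

section \<open>The mean squared error\<close>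

text \<open>Independence and centring remove the cross terms. Both claims go through one induction,
  because the cross term of the second vanishes by the first.\<close>

lemma expectation_square_sum_Pi_pmf:
  fixes f :: "'i \<Rightarrow> 'a \<Rightarrow> real"
  assumes A: "finite A" and fin: "\<And>i. i \<in> A \<Longrightarrow> finite (set_pmf (Q i))"
    and mean: "\<And>i. i \<in> A \<Longrightarrow> measure_pmf.expectation (Q i) (f i) = 0"
  shows "measure_pmf.expectation (Pi_pmf A dflt Q) (\<lambda>w. \<Sum>i\<in>A. f i (w i)) = 0"
    and "measure_pmf.expectation (Pi_pmf A dflt Q) (\<lambda>w. (\<Sum>i\<in>A. f i (w i))\<^sup>2) =
      (\<Sum>i\<in>A. measure_pmf.expectation (Q i) (\<lambda>x. (f i x)\<^sup>2))"
proof -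
  have "measure_pmf.expectation (Pi_pmf A dflt Q) (\<lambda>w. \<Sum>i\<in>A. f i (w i)) = 0 \<and>
    measure_pmf.expectation (Pi_pmf A dflt Q) (\<lambda>w. (\<Sum>i\<in>A. f i (w i))\<^sup>2) =
      (\<Sum>i\<in>A. measure_pmf.expectation (Q i) (\<lambda>x. (f i x)\<^sup>2))"
    using A fin mean
  proof (induction A rule: finite_induct)
    case empty
    show ?case by simp
  next
    case (insert x A)
    let ?P = "Pi_pmf A dflt Q" and ?S = "\<lambda>w. \<Sum>i\<in>A. f i (w i)"
    have finP: "finite (set_pmf ?P)" and finx: "finite (set_pmf (Q x))"
      using insert by (auto intro: finite_set_Pi_pmf)
    have S: "(\<Sum>i\<in>insert x A. f i ((w(x := y)) i)) = f x y + ?S w" for w y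
    proof -
      have "(\<Sum>i\<in>A. f i ((w(x := y)) i)) = ?S w" using insert.hyps by (intro sum.cong) auto
      then show ?thesis using insert.hyps by simp
    qed
    have IH: "measure_pmf.expectation ?P ?S = 0"
      "measure_pmf.expectation ?P (\<lambda>w. (?S w)\<^sup>2) = (\<Sum>i\<in>A. measure_pmf.expectation (Q i) (\<lambda>x. (f i x)\<^sup>2))"
      using insert by auto
    have sq: "measure_pmf.expectation ?P (\<lambda>w. (f x y + ?S w)\<^sup>2) = (f x y)\<^sup>2 + measure_pmf.expectation ?P (\<lambda>w. (?S w)\<^sup>2)" for y
    proof -
      have "measure_pmf.expectation ?P (\<lambda>w. (f x y + ?S w)\<^sup>2) =
          measure_pmf.expectation ?P (\<lambda>w. (f x y)\<^sup>2 + (2 * f x y * ?S w + (?S w)\<^sup>2))"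
        by (intro Bochner_Integration.integral_cong) (auto simp: power2_sum)
      then show ?thesis by (simp add: expectation_pmf_add[OF finP] IH(1))
    qed
    have E: "measure_pmf.expectation (Pi_pmf (insert x A) dflt Q) h =
        measure_pmf.expectation (Q x) (\<lambda>y. measure_pmf.expectation ?P (\<lambda>w. h (w(x := y))))" for h :: "_ \<Rightarrow> real"
      by (rule expectation_Pi_pmf_insert) (use insert in auto)
    show ?case
      unfolding E S sq IH(2) using insert.hyps
      by (simp add: expectation_pmf_add[OF finP] expectation_pmf_add[OF finx] IH(1) insert.prems)
  qed
  then show "measure_pmf.expectation (Pi_pmf A dflt Q) (\<lambda>w. \<Sum>i\<in>A. f i (w i)) = 0"
    and "measure_pmf.expectation (Pi_pmf A dflt Q) (\<lambda>w. (\<Sum>i\<in>A. f i (w i))\<^sup>2) =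
      (\<Sum>i\<in>A. measure_pmf.expectation (Q i) (\<lambda>x. (f i x)\<^sup>2))" by auto
qed

text \<open>Sums and counts ignore order; this removes the shuffler from the error.\<close>

lemma analyzer_cong_mset:
  assumes "mset xs = mset ys"
  shows "analyzer k \<gamma> xs = analyzer k \<gamma> ys"
proof -
  have "sum_list (map f xs) = sum_list (map f ys)" for f :: "_ \<Rightarrow> real"
    using assms by (metis mset_map sum_mset_sum_list)
  moreover have "mset (map fst xs) = mset (map fst ys)" using assms by simp
  then have "count_list (map fst xs) l = count_list (map fst ys) l" for l
    by (metis count_mset)
  ultimately show ?thesis by (simp add: analyzer_def z_hat_def)
qed

text \<open>One user's share of the error in coordinate \<open>l\<close>. The correction by the
  number of submissions is spread evenly, \<open>\<gamma> / 2\<close> for each message that carries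
  the label \<open>l\<close>.\<close>

definition coordinate_error :: "nat \<Rightarrow> real \<Rightarrow> real ^ 'd::finite \<Rightarrow> 'd \<Rightarrow> 'd message \<Rightarrow> real" where
  "coordinate_error k \<gamma> x l m =
    (if fst m = l then (real (snd m) / real k - \<gamma> / 2) / (1 - \<gamma>) - x $ l else 0)"

lemma error_component:
  "(analyzer k \<gamma> (map r [0..<n]) - sampled_sum n D r) $ l = (\<Sum>i<n. coordinate_error k \<gamma> (D i) l (r i))"
proof -
  have sum: "sum_list (map f [0..<n]) = (\<Sum>i<n. f i)" for f :: "nat \<Rightarrow> real"
    by (simp add: interv_sum_list_conv_sum_set_nat atLeast0LessThan)
  have count: "real (count_list (map (\<lambda>i. fst (r i)) [0..<n]) l) = (\<Sum>i<n. of_bool (fst (r i) = l))"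
    by (induction n) auto
  have "sampled_sum n D r $ l = (\<Sum>i<n. if fst (r i) = l then D i $ l else 0)"
    by (auto simp: sampled_sum_def axis_def intro!: sum.cong)
  moreover have "analyzer k \<gamma> (map r [0..<n]) $ l =
      (1 / real k * (\<Sum>i<n. if fst (r i) = l then real (snd (r i)) else 0) - \<gamma> / 2 * (\<Sum>i<n. of_bool (fst (r i) = l))) / (1 - \<gamma>)"
    by (simp add: analyzer_def debias_def z_hat_def count sum o_def case_prod_beta' del: sum_of_bool_eq)
  moreover have "\<dots> = (\<Sum>i<n. (1 / real k * (if fst (r i) = l then real (snd (r i)) else 0) - \<gamma> / 2 * of_bool (fst (r i) = l)) / (1 - \<gamma>))"
    by (simp only: sum_distrib_left sum_subtractf[symmetric] sum_divide_distrib)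
  ultimately have "(analyzer k \<gamma> (map r [0..<n]) - sampled_sum n D r) $ l =
    (\<Sum>i<n. (1 / real k * (if fst (r i) = l then real (snd (r i)) else 0) - \<gamma> / 2 * of_bool (fst (r i) = l)) / (1 - \<gamma>)
      - (if fst (r i) = l then D i $ l else 0))"
    by (simp only: vector_minus_component sum_subtractf)
  also have "\<dots> = (\<Sum>i<n. coordinate_error k \<gamma> (D i) l (r i))"
    by (intro sum.cong) (auto simp: coordinate_error_def)
  finally show ?thesis .
qed

lemma squared_error_conv:
  fixes D :: "'d::finite dataset"
  shows "squared_error k \<gamma> n D = measure_pmf.expectation (Pi_pmf {..<n} undefined (\<lambda>i. randomizer k \<gamma> (D i)))
    (\<lambda>r. \<Sum>l\<in>UNIV. (\<Sum>i<n. coordinate_error k \<gamma> (D i) l (r i))\<^sup>2)"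
proof -
  let ?P = "Pi_pmf {..<n} undefined (\<lambda>i. randomizer k \<gamma> (D i))"
  have mset: "mset s = mset ms" if "s \<in> set_pmf (shuffler ms)" for s ms :: "'d message list"
  proof -
    have "{\<pi>. \<pi> permutes {..<length ms}} \<noteq> {}" using permutes_id by blast
    from set_pmf_of_set[OF this finite_permutations[OF finite_lessThan]] that
    obtain \<pi> where "\<pi> permutes {..<length ms}" "s = permute_list \<pi> ms"
      by (auto simp: shuffler_def)
    then show ?thesis by simp
  qed
  let ?h = "\<lambda>r s. (norm (analyzer k \<gamma> s - sampled_sum n D r))\<^sup>2"
  have "squared_error k \<gamma> n D =
      measure_pmf.expectation ?P (\<lambda>r. measure_pmf.expectation (shuffler (map r [0..<n])) (?h r))"
    by (simp add: squared_error_def transcript_def expectation_bind_pmf_finite finite_set_Pi_pmf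
      finite_set_randomizer finite_set_shuffler)
  also have "\<dots> = measure_pmf.expectation ?P (\<lambda>r. ?h r (map r [0..<n]))"
  proof (rule Bochner_Integration.integral_cong[OF refl])
    fix r :: "nat \<Rightarrow> 'd message"
    have "measure_pmf.expectation (shuffler (map r [0..<n])) (?h r) =
        measure_pmf.expectation (shuffler (map r [0..<n])) (\<lambda>_. ?h r (map r [0..<n]))"
      by (rule integral_cong_AE) (auto simp: AE_measure_pmf_iff dest!: mset analyzer_cong_mset[where k = k and \<gamma> = \<gamma>])
    then show "measure_pmf.expectation (shuffler (map r [0..<n])) (?h r) = ?h r (map r [0..<n])"
      by simp
  qed
  also have "\<dots> = measure_pmf.expectation ?P (\<lambda>r. \<Sum>l\<in>UNIV. (\<Sum>i<n. coordinate_error k \<gamma> (D i) l (r i))\<^sup>2)"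
    unfolding power2_norm_eq_inner inner_vec_def inner_real_def error_component
    by (simp only: power2_eq_square)
  finally show ?thesis .
qed

section \<open>Moments of the error of a single user\<close>

lemma expectation_randomizer:
  fixes h :: "'d::finite message \<Rightarrow> real"
  assumes "0 \<le> \<gamma>" "\<gamma> \<le> 1"
  shows "measure_pmf.expectation (randomizer k \<gamma> x) h =
    (\<Sum>\<alpha>\<in>UNIV. \<gamma> * (\<Sum>y\<le>k. h (\<alpha>, y)) / (real k + 1) +
      (1 - \<gamma>) * (frac (x $ \<alpha> * real k) * h (\<alpha>, nat \<lfloor>x $ \<alpha> * real k\<rfloor> + 1) +
        (1 - frac (x $ \<alpha> * real k)) * h (\<alpha>, nat \<lfloor>x $ \<alpha> * real k\<rfloor>))) / real CARD('d)"
  using expectation_flagged_randomizer[OF assms, of k x "\<lambda>m. h (snd m)"]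
  by (simp add: map_snd_flagged_randomizer[symmetric])

lemma sum_of_nat_atMost: "(\<Sum>y\<le>k. real y) = real k * (real k + 1) / 2"
  by (induction k) (auto simp: field_simps)

lemma sum_of_nat_squares_atMost: "(\<Sum>y\<le>k. (real y)\<^sup>2) = real k * (real k + 1) * (2 * real k + 1) / 6"
  by (induction k) (auto simp: field_simps power2_eq_square)

lemma expectation_randomizer_at:
  fixes x :: "real ^ 'd::finite" and h :: "'d message \<Rightarrow> real"
  assumes "0 \<le> \<gamma>" "\<gamma> \<le> 1" and h: "\<And>\<alpha> y. \<alpha> \<noteq> l \<Longrightarrow> h (\<alpha>, y) = 0"
  shows "measure_pmf.expectation (randomizer k \<gamma> x) h =
    (\<gamma> * (\<Sum>y\<le>k. h (l, y)) / (real k + 1) +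
      (1 - \<gamma>) * (frac (x $ l * real k) * h (l, nat \<lfloor>x $ l * real k\<rfloor> + 1) +
        (1 - frac (x $ l * real k)) * h (l, nat \<lfloor>x $ l * real k\<rfloor>))) / real CARD('d)"
proof -
  have "measure_pmf.expectation (randomizer k \<gamma> x) h =
    (\<Sum>\<alpha>\<in>UNIV. if \<alpha> = l then \<gamma> * (\<Sum>y\<le>k. h (l, y)) / (real k + 1) +
      (1 - \<gamma>) * (frac (x $ l * real k) * h (l, nat \<lfloor>x $ l * real k\<rfloor> + 1) +
        (1 - frac (x $ l * real k)) * h (l, nat \<lfloor>x $ l * real k\<rfloor>)) else 0) / real CARD('d)"
    unfolding expectation_randomizer[OF assms(1,2)]
    by (intro arg_cong2[of _ _ _ _ "(/)"] sum.cong refl) (auto simp: h)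
  then show ?thesis by simp
qed

text \<open>Stochastic rounding is unbiased, so given the label \<open>l\<close> the mean of
  \<open>y / k\<close> is \<open>(1 - \<gamma>) * x $ l + \<gamma> / 2\<close>, which the debiasing
  inverts.\<close>

lemma expectation_coordinate_error:
  fixes x :: "real ^ 'd::finite"
  assumes "0 \<le> \<gamma>" "\<gamma> < 1" "1 \<le> k" "0 \<le> x $ l"
  shows "measure_pmf.expectation (randomizer k \<gamma> x) (coordinate_error k \<gamma> x l) = 0"
proof -
  define g where "g y = (real y / real k - \<gamma> / 2) / (1 - \<gamma>) - x $ l" for y
  define m where "m = nat \<lfloor>x $ l * real k\<rfloor>"
  define f where "f = frac (x $ l * real k)"
  have "0 \<le> x $ l * real k" using assms by simp
  then have xl: "x $ l * real k = real m + f" by (simp add: m_def f_def frac_def)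
  have "measure_pmf.expectation (randomizer k \<gamma> x) (coordinate_error k \<gamma> x l) =
    (\<gamma> * (\<Sum>y\<le>k. g y) / (real k + 1) + (1 - \<gamma>) * (f * g (m + 1) + (1 - f) * g m)) / real CARD('d)"
    by (subst expectation_randomizer_at[OF assms(1) less_imp_le[OF assms(2)], of l])
       (auto simp: coordinate_error_def g_def m_def f_def)
  also have "(\<Sum>y\<le>k. g y) = (real k + 1) * ((1 / 2 - \<gamma> / 2) / (1 - \<gamma>) - x $ l)"
  proof -
    have "(\<Sum>y\<le>k. g y) = (\<Sum>y\<le>k. real y / (real k * (1 - \<gamma>)) - (\<gamma> / 2 / (1 - \<gamma>) + x $ l))"
      by (simp add: g_def diff_divide_distrib algebra_simps)
    also have "\<dots> = (\<Sum>y\<le>k. real y) / (real k * (1 - \<gamma>)) - (real k + 1) * (\<gamma> / 2 / (1 - \<gamma>) + x $ l)"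
      by (simp add: sum_subtractf sum_divide_distrib[symmetric] algebra_simps)
    also have "(\<Sum>y\<le>k. real y) / (real k * (1 - \<gamma>)) = (real k + 1) * (1 / 2 / (1 - \<gamma>))"
      using assms by (simp add: sum_of_nat_atMost)
    also have "(real k + 1) * (1 / 2 / (1 - \<gamma>)) - (real k + 1) * (\<gamma> / 2 / (1 - \<gamma>) + x $ l) =
        (real k + 1) * ((1 / 2 - \<gamma> / 2) / (1 - \<gamma>) - x $ l)"
      by (simp add: diff_divide_distrib right_diff_distrib distrib_left)
    finally show ?thesis .
  qed
  also have "f * g (m + 1) + (1 - f) * g m = (x $ l - \<gamma> / 2) / (1 - \<gamma>) - x $ l"
  proof -
    have "f * g (m + 1) + (1 - f) * g m = ((real m + f) / real k - \<gamma> / 2) / (1 - \<gamma>) - x $ l"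
      by (simp add: g_def add_divide_distrib diff_divide_distrib algebra_simps)
    then show ?thesis using assms(3) by (simp add: xl[symmetric])
  qed
  finally show ?thesis using assms by (simp add: divide_simps) (simp add: algebra_simps)
qed

text \<open>
  The variance of \<open>y / k\<close> for the message of a user with value \<open>x\<close>: the spread of the two mixture
  means, the variance \<open>1 / 12 + 1 / (6 k)\<close> of the blanket, and the variance of the rounding.
\<close>

definition message_variance :: "nat \<Rightarrow> real \<Rightarrow> real \<Rightarrow> real" where
  "message_variance k \<gamma> x = \<gamma> * (1 - \<gamma>) * (x - 1 / 2)\<^sup>2 + \<gamma> * (1 / 12 + 1 / (6 * real k)) +
     (1 - \<gamma>) * (frac (x * real k) * (1 - frac (x * real k)) / (real k)\<^sup>2)"

text \<open>Both mixture components are split into variance plus squared distance of their mean from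
  the overall mean \<open>c\<close>. The blanket has mean \<open>1 / 2\<close>, the rounded value
  has mean \<open>x $ l\<close>.\<close>

lemma expectation_square_coordinate_error:
  fixes x :: "real ^ 'd::finite"
  assumes "0 \<le> \<gamma>" "\<gamma> < 1" "1 \<le> k" "0 \<le> x $ l"
  shows "measure_pmf.expectation (randomizer k \<gamma> x) (\<lambda>m. (coordinate_error k \<gamma> x l m)\<^sup>2) =
    message_variance k \<gamma> (x $ l) / (1 - \<gamma>)\<^sup>2 / real CARD('d)"
proof -
  define c where "c = \<gamma> / 2 + (1 - \<gamma>) * x $ l"
  define g where "g y = (real y / real k - c)\<^sup>2" for y
  define m where "m = nat \<lfloor>x $ l * real k\<rfloor>"
  define f where "f = frac (x $ l * real k)"
  have "0 \<le> x $ l * real k" using assms by simp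
  then have xl: "x $ l * real k = real m + f" by (simp add: m_def f_def frac_def)
  have err: "((real y / real k - \<gamma> / 2) / (1 - \<gamma>) - x $ l)\<^sup>2 = g y / (1 - \<gamma>)\<^sup>2" for y
  proof -
    have "(real y / real k - \<gamma> / 2) / (1 - \<gamma>) - x $ l = (real y / real k - c) / (1 - \<gamma>)"
      using assms(2) by (simp add: c_def diff_divide_distrib add_divide_distrib)
    then show ?thesis by (simp add: g_def power_divide)
  qed
  have "measure_pmf.expectation (randomizer k \<gamma> x) (\<lambda>m. (coordinate_error k \<gamma> x l m)\<^sup>2) =
    (\<gamma> * (\<Sum>y\<le>k. g y / (1 - \<gamma>)\<^sup>2) / (real k + 1) +
      (1 - \<gamma>) * (f * (g (m + 1) / (1 - \<gamma>)\<^sup>2) + (1 - f) * (g m / (1 - \<gamma>)\<^sup>2))) / real CARD('d)"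
    by (subst expectation_randomizer_at[OF assms(1) less_imp_le[OF assms(2)], of l])
       (auto simp: coordinate_error_def err[symmetric] m_def f_def)
  also have "\<dots> = (\<gamma> * ((\<Sum>y\<le>k. g y) / (real k + 1)) + (1 - \<gamma>) * (f * g (m + 1) + (1 - f) * g m)) / (1 - \<gamma>)\<^sup>2 / real CARD('d)"
    by (simp add: sum_divide_distrib[symmetric] add_divide_distrib distrib_left) (simp add: algebra_simps)
  also have "(\<Sum>y\<le>k. g y) / (real k + 1) = (c - 1 / 2)\<^sup>2 + 1 / 12 + 1 / (6 * real k)"
  proof -
    have "(\<Sum>y\<le>k. g y) = (\<Sum>y\<le>k. (real y)\<^sup>2 * (1 / (real k)\<^sup>2) - real y * (2 * c / real k) + c\<^sup>2)"
      by (simp add: g_def power2_diff power_divide mult_ac add.commute add_diff_eq diff_add_eq)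
    also have "\<dots> = (\<Sum>y\<le>k. (real y)\<^sup>2) * (1 / (real k)\<^sup>2) - (\<Sum>y\<le>k. real y) * (2 * c / real k) + (real k + 1) * c\<^sup>2"
      by (simp only: sum.distrib sum_subtractf sum_distrib_right) simp
    also have "\<dots> = (real k + 1) * ((2 * real k + 1) / (6 * real k) - c + c\<^sup>2)"
      using assms(3) unfolding sum_of_nat_atMost sum_of_nat_squares_atMost
      by (simp add: power2_eq_square field_simps)
    finally show ?thesis using assms(3) by (simp add: power2_eq_square field_simps)
  qed
  also have "f * g (m + 1) + (1 - f) * g m = (x $ l - c)\<^sup>2 + f * (1 - f) / (real k)\<^sup>2"
  proof -
    have "f * g (m + 1) + (1 - f) * g m = ((real m + f) / real k - c)\<^sup>2 + f * (1 - f) / (real k)\<^sup>2"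
      using assms(3) by (simp add: g_def power2_eq_square field_simps)
    then show ?thesis using assms(3) by (simp add: xl[symmetric])
  qed
  also have "\<gamma> * ((c - 1 / 2)\<^sup>2 + 1 / 12 + 1 / (6 * real k)) + (1 - \<gamma>) * ((x $ l - c)\<^sup>2 + f * (1 - f) / (real k)\<^sup>2) =
      message_variance k \<gamma> (x $ l)"
  proof -
    define w where "w = x $ l - 1 / 2"
    have c: "c - 1 / 2 = (1 - \<gamma>) * w" "x $ l - c = \<gamma> * w"
      by (simp_all add: c_def w_def field_simps)
    have "\<gamma> * (c - 1 / 2)\<^sup>2 + (1 - \<gamma>) * (x $ l - c)\<^sup>2 = \<gamma> * (1 - \<gamma>) * w\<^sup>2"
      unfolding c by (simp add: power2_eq_square algebra_simps)
    then show ?thesis by (simp add: message_variance_def f_def w_def algebra_simps)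
  qed
  finally show ?thesis .
qed

text \<open>At resolution 1 the message is a single bit, whose variance is at most
  \<open>1 / 4\<close>.\<close>

lemma message_variance_le_quarter:
  assumes "0 \<le> \<gamma>" "\<gamma> \<le> 1" "0 \<le> x" "x \<le> 1"
  shows "message_variance 1 \<gamma> x \<le> 1 / 4"
proof -
  have "frac x * (1 - frac x) = 1 / 4 - (x - 1 / 2)\<^sup>2"
  \<comment> \<open>\<open>frac\<close> drops to 0 at 1, where both sides vanish.\<close>
  proof (cases "x = 1")
    case True then show ?thesis by (simp add: power2_eq_square)
  next
    case False
    then have "frac x = x" using assms by (simp add: frac_eq)
    then show ?thesis by (simp add: power2_eq_square algebra_simps)
  qed
  then have "message_variance 1 \<gamma> x = \<gamma> * (1 - \<gamma>) * (x - 1 / 2)\<^sup>2 + \<gamma> / 4 + (1 - \<gamma>) * (1 / 4 - (x - 1 / 2)\<^sup>2)"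
    by (simp add: message_variance_def)
  also have "\<gamma> * (1 - \<gamma>) * w + \<gamma> / 4 + (1 - \<gamma>) * (1 / 4 - w) = 1 / 4 - (1 - \<gamma>)\<^sup>2 * w" for w
    by (simp add: power2_eq_square field_simps)
  finally show ?thesis by simp
qed

text \<open>Replacing both quadratic factors by their maximum \<open>1 / 4\<close> leaves \<gamma>
  with the coefficient \<open>1 / 3 + u / 6 - u\<^sup>2 / 4\<close>, where \<open>u = 1 / k\<close>.
  Its maximum is \<open>13 / 36\<close>, at \<open>u = 1 / 3\<close>, shown by completing the
  square.\<close>

lemma message_variance_le:
  assumes "0 \<le> \<gamma>" "\<gamma> \<le> 1" "0 \<le> x" "x \<le> 1" "1 \<le> k"
  shows "message_variance k \<gamma> x \<le> 1 / (4 * (real k)\<^sup>2) + 13 / 36 * \<gamma>"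
proof -
  have "\<bar>x - 1 / 2\<bar> \<le> 1 / 2" using assms by linarith
  then have "(x - 1 / 2)\<^sup>2 \<le> 1 / 4" using power_mono[of "\<bar>x - 1 / 2\<bar>" "1 / 2" 2] by (simp add: power2_eq_square)
  then have "\<gamma> * (1 - \<gamma>) * (x - 1 / 2)\<^sup>2 \<le> \<gamma> * (1 - \<gamma>) * (1 / 4)"
    using assms by (intro mult_left_mono) auto
  also have "\<dots> \<le> \<gamma> * (1 / 4)" using assms by (simp add: mult_left_le)
  finally have 1: "\<gamma> * (1 - \<gamma>) * (x - 1 / 2)\<^sup>2 \<le> \<gamma> * (1 / 4)" .
  let ?f = "frac (x * real k)"
  have "?f * (1 - ?f) = 1 / 4 - (?f - 1 / 2)\<^sup>2" by (simp add: power2_eq_square algebra_simps)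
  then have "?f * (1 - ?f) \<le> 1 / 4" by simp
  then have "(1 - \<gamma>) * (?f * (1 - ?f) / (real k)\<^sup>2) \<le> (1 - \<gamma>) * (1 / 4 / (real k)\<^sup>2)"
    using assms by (intro mult_left_mono divide_right_mono) auto
  also have "\<dots> = 1 / (4 * (real k)\<^sup>2) - \<gamma> * (1 / (4 * (real k)\<^sup>2))"
    by (simp add: left_diff_distrib diff_divide_distrib)
  finally have 2: "(1 - \<gamma>) * (?f * (1 - ?f) / (real k)\<^sup>2) \<le> 1 / (4 * (real k)\<^sup>2) - \<gamma> * (1 / (4 * (real k)\<^sup>2))" .
  have "0 \<le> (1 / (2 * real k) - 1 / 6)\<^sup>2" by simp
  also have "\<dots> = 13 / 36 - (1 / 4 + (1 / 12 + 1 / (6 * real k)) - 1 / (4 * (real k)\<^sup>2))"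
    using assms(5) by (simp add: power2_eq_square field_simps)
  finally have "\<gamma> * (1 / 4 + (1 / 12 + 1 / (6 * real k)) - 1 / (4 * (real k)\<^sup>2)) \<le> \<gamma> * (13 / 36)"
    using assms(1) by (intro mult_left_mono) auto
  then show ?thesis
    using 1 2 unfolding message_variance_def by (simp only: distrib_left right_diff_distrib)
qed

text \<open>Each coordinate is sampled with probability \<open>1 / d\<close>, so summing over the
  \<open>d\<close> coordinates cancels the dimension.\<close>

lemma mse_le:
  assumes "0 \<le> \<gamma>" "\<gamma> < 1" "1 \<le> k"
    and v: "\<And>x. 0 \<le> x \<Longrightarrow> x \<le> 1 \<Longrightarrow> message_variance k \<gamma> x \<le> v"
  shows "mse TYPE('d::finite) k \<gamma> n \<le> real n * (v / (1 - \<gamma>)\<^sup>2)"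
  unfolding mse_def
proof (rule cSUP_least[OF datasets_nonempty])
  fix D :: "'d dataset" assume D: "D \<in> datasets n"
  then have box: "0 \<le> D i $ l" "D i $ l \<le> 1" if "i < n" for i l
    using that by (auto simp: datasets_def PiE_iff)
  have fin: "finite (set_pmf (Pi_pmf {..<n} undefined (\<lambda>i. randomizer k \<gamma> (D i))))"
    by (intro finite_set_Pi_pmf) (auto simp: finite_set_randomizer)
  have "squared_error k \<gamma> n D = (\<Sum>l\<in>UNIV. \<Sum>i<n. measure_pmf.expectation (randomizer k \<gamma> (D i))
      (\<lambda>m. (coordinate_error k \<gamma> (D i) l m)\<^sup>2))"
    unfolding squared_error_conv expectation_pmf_sum[OF fin]
    by (intro sum.cong refl expectation_square_sum_Pi_pmf(2))
       (use assms box in \<open>auto simp: finite_set_randomizer intro!: expectation_coordinate_error\<close>)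
  also have "\<dots> = (\<Sum>l\<in>UNIV. \<Sum>i<n. message_variance k \<gamma> (D i $ l) / (1 - \<gamma>)\<^sup>2 / real CARD('d))"
    by (intro sum.cong refl expectation_square_coordinate_error) (use assms box in auto)
  also have "\<dots> \<le> (\<Sum>l\<in>(UNIV :: 'd set). \<Sum>i<n. v / (1 - \<gamma>)\<^sup>2 / real CARD('d))"
    by (intro sum_mono divide_right_mono v) (use box in auto)
  also have "\<dots> = real n * (v / (1 - \<gamma>)\<^sup>2)" by simp
  finally show "squared_error k \<gamma> n D \<le> real n * (v / (1 - \<gamma>)\<^sup>2)" .
qed

section \<open>Choice of the resolution\<close>

text \<open>The coefficient \<open>C\<close> in \<open>gamma_param d n \<epsilon> \<delta> k = C * d * k / (n - 1)\<close>.\<close>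

definition noise_coeff :: "real \<Rightarrow> real \<Rightarrow> real" where
  "noise_coeff \<epsilon> \<delta> = (if \<epsilon> < 1 then max (14 * ln (2 / \<delta>) / \<epsilon>\<^sup>2) (27 / \<epsilon>)
     else max (80 * ln (2 / \<delta>) / \<epsilon>\<^sup>2) (36 / (11 * \<epsilon>)))"

lemma gamma_param_conv:
  assumes "n \<ge> 2"
  shows "gamma_param d n \<epsilon> \<delta> k = noise_coeff \<epsilon> \<delta> * (real d * real k / (real n - 1))"
proof -
  have "0 \<le> real d * real k / (real n - 1)" using assms by simp
  then have "max a b * (real d * real k / (real n - 1)) =
      max (a * (real d * real k / (real n - 1))) (b * (real d * real k / (real n - 1)))" for a b
    by (simp only: max_mult_distrib_right if_True)
  then show ?thesis
    unfolding gamma_param_def noise_coeff_def if_distribR if_distrib[of "\<lambda>a. a * _"]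
    by (simp add: mult_ac)
qed

text \<open>The constant is \<open>80 * (2 / 3) / 36\<close>: the extreme case
  \<open>\<epsilon> = 6\<close>, \<open>\<delta> = 1\<close>, with \<open>ln 2\<close> replaced by
  its lower bound \<open>2 / 3\<close>.\<close>

lemma noise_coeff_ge:
  assumes "0 < \<epsilon>" "\<epsilon> < 6" "0 < \<delta>" "\<delta> \<le> 1"
  shows "40 / 27 \<le> noise_coeff \<epsilon> \<delta>"
proof (cases "\<epsilon> < 1")
  case True
  have "40 / 27 \<le> 27 / \<epsilon>" using assms True by (simp add: field_simps)
  then show ?thesis using True by (simp add: noise_coeff_def le_max_iff_disj)
next
  case False
  have "\<epsilon>\<^sup>2 \<le> 6\<^sup>2" using assms by (intro power_mono) auto
  have "ln 2 \<le> ln (2 / \<delta>)" using assms by (simp add: field_simps)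
  then have "2 / 3 \<le> ln (2 / \<delta>)" using ln2_ge_two_thirds by linarith
  then have "40 / 27 \<le> 80 * ln (2 / \<delta>) / \<epsilon>\<^sup>2"
    using assms \<open>\<epsilon>\<^sup>2 \<le> 6\<^sup>2\<close> by (simp add: field_simps)
  then show ?thesis using False by (simp add: noise_coeff_def le_max_iff_disj)
qed

section \<open>Privacy at the prescribed noise level\<close>

lemma shuffled_messages_private:
  assumes "n \<ge> 2" "0 < \<epsilon>" "\<epsilon> < 6" "0 < \<delta>" "\<delta> \<le> 1" "k \<ge> 1"
    and "gamma_param CARD('d) n \<epsilon> \<delta> k < 1"
  shows "differentially_private (neighbouring n)
    (shuffled_messages k (gamma_param CARD('d) n \<epsilon> \<delta> k) n :: 'd::finite dataset \<Rightarrow> 'd message list pmf) \<epsilon> \<delta>"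
  unfolding differentially_private_def
proof (intro allI impI)
  fix D D' :: "'d dataset" and E
  assume neigh: "neighbouring n D D'"
  let ?L = "ln (2 / \<delta>)"
  define \<gamma> where "\<gamma> = gamma_param CARD('d) n \<epsilon> \<delta> k"
  define \<kappa> where "\<kappa> = (if \<epsilon> < 1 then \<epsilon>\<^sup>2 / 7 else \<epsilon>\<^sup>2 / 40)"
  have \<kappa>: "0 < \<kappa>" using assms by (simp add: \<kappa>_def)
  obtain t where t: "0 \<le> t" "t \<le> 1 / 4" "\<kappa> \<le> 2 - exp t - exp (- t * exp \<epsilon>)"
  proof (cases "\<epsilon> < 1")
    case True
    then show ?thesis
      using chernoff_rate_small[of \<epsilon>] assms by (intro that[of "\<epsilon> / 5"]) (auto simp: \<kappa>_def)
  next
    case False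
    then show ?thesis
      using chernoff_rate_large[of \<epsilon>] assms that by (auto simp: \<kappa>_def)
  qed
  have L: "0 < ?L" using assms by (simp add: field_simps)
  \<comment> \<open>In both ranges the first entry of the maximum is
    \<open>2 * ?L / \<kappa>\<close>, as 14 = 2 * 7 and 80 = 2 * 40. The factor 2 pays for
    \<open>k / (k + 1) \<ge> 1 / 2\<close>.\<close>
  have C: "2 * ?L / \<kappa> \<le> noise_coeff \<epsilon> \<delta>" by (auto simp: noise_coeff_def \<kappa>_def field_simps)
  have C0: "0 \<le> noise_coeff \<epsilon> \<delta>" using noise_coeff_ge[of \<epsilon> \<delta>] assms by linarith
  have \<gamma>: "0 \<le> \<gamma>" "\<gamma> \<le> 1"
    using assms C0 by (auto simp: \<gamma>_def gamma_param_conv)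
  \<comment> \<open>The expected number of blanket copies of one fixed message among the other
    \<open>n - 1\<close> users.\<close>
  define \<mu> where "\<mu> = (real n - 1) * (\<gamma> / (real CARD('d) * (real k + 1)))"
  have "?L / \<kappa> = 2 * ?L / \<kappa> * (1 / 2)" by simp
  also have "\<dots> \<le> noise_coeff \<epsilon> \<delta> * (real k / (real k + 1))"
    using C C0 assms(6) by (intro mult_mono) (auto simp: field_simps)
  also have "\<dots> = \<mu>"
    using assms(1) by (simp add: \<mu>_def \<gamma>_def gamma_param_conv)
  finally have "?L \<le> \<mu> * \<kappa>" using \<kappa> by (simp add: field_simps)
  also have "\<dots> \<le> \<mu> * (2 - exp t - exp (- t * exp \<epsilon>))"
    using t(3) \<gamma> assms(1) by (intro mult_left_mono) (auto simp: \<mu>_def)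
  finally have "t + \<mu> * (exp t + exp (- t * exp \<epsilon>) - 2) \<le> t - ?L"
    by (simp add: algebra_simps)
  then have "exp (t + \<mu> * (exp t + exp (- t * exp \<epsilon>) - 2)) \<le> exp (t - ?L)" by simp
  also have "\<dots> = exp t * (\<delta> / 2)" using assms by (simp add: exp_diff)
  \<comment> \<open>The 2 in \<open>ln (2 / \<delta>)\<close> is spent here: it absorbs
    \<open>exp t\<close>, which stems from the 1 in \<open>N + 1\<close>.\<close>
  also have "\<dots> \<le> 2 * (\<delta> / 2)"
  proof (intro mult_right_mono)
    have "exp t \<le> exp (1 / 4)" using t by simp
    also have "\<dots> \<le> 2" using exp_le_quadratic[of "1 / 4"] by (simp add: power2_eq_square)
    finally show "exp t \<le> 2" .
  qed (use assms in auto)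
  finally have "exp (t + \<mu> * (exp t + exp (- t * exp \<epsilon>) - 2)) \<le> \<delta>" by simp
  moreover have "measure_pmf.prob (shuffled_messages k \<gamma> n D) E \<le>
      exp \<epsilon> * measure_pmf.prob (shuffled_messages k \<gamma> n D') E + exp (t + \<mu> * (exp t + exp (- t * exp \<epsilon>) - 2))"
    unfolding \<mu>_def using assms(2)
    by (intro shuffled_messages_blanket_bound neigh \<gamma> t) auto
  ultimately show "measure_pmf.prob (shuffled_messages k (gamma_param CARD('d) n \<epsilon> \<delta> k) n D) E \<le>
      exp \<epsilon> * measure_pmf.prob (shuffled_messages k (gamma_param CARD('d) n \<epsilon> \<delta> k) n D') E + \<delta>"
    unfolding \<gamma>_def by linarith
qed

section \<open>Balancing rounding against noise\<close>

lemma balanced_rate_bound: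
  fixes \<kappa> :: real
  assumes "1 / 2 \<le> \<kappa>" "\<kappa> \<le> 86 / 100"
  shows "1 / (4 * \<kappa>\<^sup>2) + 13 / 8 * \<kappa> \<le> 2"
proof -
  \<comment> \<open>On a short interval the increasing factor is bounded at the left end
    \<open>a\<close> and the decreasing one at the right end \<open>b\<close>; three intervals cover
    the range.\<close>
  have *: "1 / 4 \<le> \<kappa>\<^sup>2 * (2 - 13 / 8 * \<kappa>)" if "a \<le> \<kappa>" "\<kappa> \<le> b" "0 \<le> a" "b \<le> 1" "1 / 4 \<le> a\<^sup>2 * (2 - 13 / 8 * b)" for a b
  proof -
    have "a\<^sup>2 * (2 - 13 / 8 * b) \<le> \<kappa>\<^sup>2 * (2 - 13 / 8 * \<kappa>)"
      using that by (intro mult_mono power_mono) auto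
    then show ?thesis using that by linarith
  qed
  consider "\<kappa> \<le> 6 / 10" | "6 / 10 \<le> \<kappa>" "\<kappa> \<le> 7 / 10" | "7 / 10 \<le> \<kappa>" by linarith
  then have "1 / 4 \<le> \<kappa>\<^sup>2 * (2 - 13 / 8 * \<kappa>)"
  proof cases
    case 1 then show ?thesis using *[of "1/2" "6/10"] assms by (simp add: power2_eq_square)
  next
    case 2 then show ?thesis using *[of "6/10" "7/10"] by (simp add: power2_eq_square)
  next
    case 3 then show ?thesis using *[of "7/10" "86/100"] assms by (simp add: power2_eq_square)
  qed
  moreover have "0 < \<kappa>\<^sup>2" using assms by simp
  ultimately have "1 / 4 / \<kappa>\<^sup>2 \<le> 2 - 13 / 8 * \<kappa>" by (simp only: pos_divide_le_eq) (simp add: mult.commute)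
  then show ?thesis by simp
qed

text \<open>
  With \<open>s\<close> the cube root of \<open>C d / (4 n)\<close> the target is \<open>2 s\<^sup>2\<close>. If \<open>s\<^sup>2 \<ge> 1 / 8\<close> the trivial bound
  \<open>1 / 4\<close> at \<open>k = 1\<close> suffices; otherwise \<open>k = \<lceil>1 / (2 s)\<rceil>\<close> balances rounding against noise, and
  the slack of the balanced bound absorbs both the integrality of \<open>k\<close> and \<open>n / (n - 1) \<le> 9 / 8\<close>.
\<close>

lemma exists_resolution:
  fixes C :: real
  assumes "n \<ge> 2" "d \<ge> 1" "40 / 27 \<le> C"
    and feasible: "C * (real d / (real n - 1)) < 1"
  obtains k where "k \<ge> 1" "C * (real d * real k / (real n - 1)) < 1"
    "\<And>x. 0 \<le> x \<Longrightarrow> x \<le> 1 \<Longrightarrow> message_variance k (C * (real d * real k / (real n - 1))) x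
      \<le> 2 * (C * real d / (4 * real n)) powr (2 / 3)"
proof -
  define B where "B = C * (real d / (real n - 1))"
  define s where "s = (C * real d / (4 * real n)) powr (1 / 3)"
  define \<beta> where "\<beta> = C * real d / (4 * real n)"
  have pos: "0 < \<beta>" using assms by (simp add: \<beta>_def)
  have s: "0 < s" "s ^ 3 = C * real d / (4 * real n)"
    using pos unfolding s_def \<beta>_def[symmetric] by (simp_all add: powr_numeral[symmetric] powr_powr del: powr_numeral)
  have s2: "(C * real d / (4 * real n)) powr (2 / 3) = s\<^sup>2"
    using pos unfolding s_def \<beta>_def[symmetric] by (simp add: powr_numeral[symmetric] powr_powr del: powr_numeral)
  have B: "0 \<le> B" "B < 1" "C * (real d * real k / (real n - 1)) = B * real k" for k
    using assms by (auto simp: B_def)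
  show ?thesis
  proof (cases "1 / 8 \<le> s\<^sup>2")
    case True
    show ?thesis
    proof (rule that[of 1])
      fix x :: real assume "0 \<le> x" "x \<le> 1"
      then have "message_variance 1 B x \<le> 1 / 4" using B by (intro message_variance_le_quarter) auto
      then show "message_variance 1 (C * (real d * real 1 / (real n - 1))) x \<le> 2 * (C * real d / (4 * real n)) powr (2 / 3)"
        using True unfolding s2 B(3) by simp
    qed (use feasible in auto)
  next
    case False
    \<comment> \<open>\<open>36 / 100\<close> is a rational slightly above the square root of
      \<open>1 / 8\<close>.\<close>
    then have "s\<^sup>2 \<le> (36 / 100)\<^sup>2" by (simp add: power2_eq_square)
    then have s_le: "s \<le> 36 / 100" by (rule power2_le_imp_le) simp
    \<comment> \<open>For \<open>n \<le> 8\<close> the bound on \<open>C\<close> gives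
      \<open>s ^ 3 \<ge> 40 / 27 / 32\<close>, against \<open>s\<^sup>2 < 1 / 8\<close>; comparing
      sixth powers avoids roots.\<close>
    have n: "n \<ge> 9"
    proof (rule ccontr)
      assume "\<not> n \<ge> 9"
      then have "real n \<le> 8" by simp
      moreover have "40 / 27 * 1 \<le> C * real d" using assms by (intro mult_mono) auto
      ultimately have "40 / 27 / 32 \<le> C * real d / (4 * real n)"
        using assms(1) by (intro frac_le) auto
      then have "(40 / 27 / 32)\<^sup>2 \<le> (s ^ 3)\<^sup>2" unfolding s(2) by (intro power_mono) auto
      also have "\<dots> = (s\<^sup>2) ^ 3" by (simp add: power_mult[symmetric])
      also have "\<dots> \<le> (1 / 8) ^ 3" using False by (intro power_mono) auto
      finally show False by (simp add: power2_eq_square power3_eq_cube)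
    qed
    have B_le: "B \<le> 9 / 2 * s ^ 3"
    proof -
      have "B = 4 * s ^ 3 * (real n / (real n - 1))" using n by (simp add: B_def s(2) field_simps)
      also have "\<dots> \<le> 4 * s ^ 3 * (9 / 8)" using n s(1) by (intro mult_left_mono) (auto simp: field_simps)
      finally show ?thesis by simp
    qed
    define k where "k = nat \<lceil>1 / (2 * s)\<rceil>"
    have k: "1 / (2 * s) \<le> real k" "real k \<le> 1 / (2 * s) + 1"
    proof -
      have "0 \<le> 1 / (2 * s)" using s(1) by simp
      then show "1 / (2 * s) \<le> real k" "real k \<le> 1 / (2 * s) + 1"
        unfolding k_def by linarith+
    qed
    have "0 < 1 / (2 * s)" using s(1) by simp
    then have k1: "k \<ge> 1" using k(1) by (cases k) auto
    define \<kappa> where "\<kappa> = real k * s"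
    \<comment> \<open>Multiplying the bounds on \<open>k\<close> by \<open>s\<close> gives
      \<open>1 / 2 \<le> \<kappa> \<le> 1 / 2 + s\<close>, and
      \<open>s \<le> 36 / 100\<close>.\<close>
    have \<kappa>: "1 / 2 \<le> \<kappa>" "\<kappa> \<le> 86 / 100"
      using mult_right_mono[OF k(1), of s] mult_right_mono[OF k(2), of s] s s_le
      by (auto simp: \<kappa>_def distrib_right)
    \<comment> \<open>One bound serves twice: it keeps the noise level below 1 and later controls
      the noise term of the variance.\<close>
    have Bk: "B * real k \<le> 9 / 2 * s\<^sup>2 * \<kappa>"
      using mult_right_mono[OF B_le, of "real k"] by (simp add: \<kappa>_def power2_eq_square power3_eq_cube mult_ac)
    also have "\<dots> \<le> 9 / 2 * (1 / 8) * (86 / 100)"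
      using False \<kappa> by (intro mult_mono) auto
    finally have Bk1: "B * real k < 1" by simp
    show ?thesis
    proof (rule that[OF k1])
      show "C * (real d * real k / (real n - 1)) < 1" using Bk1 B(3) by simp
      fix x :: real assume "0 \<le> x" "x \<le> 1"
      then have "message_variance k (B * real k) x \<le> 1 / (4 * (real k)\<^sup>2) + 13 / 36 * (B * real k)"
        using B Bk1 k1 by (intro message_variance_le) auto
      also have "\<dots> \<le> 1 / (4 * (real k)\<^sup>2) + 13 / 36 * (9 / 2 * s\<^sup>2 * \<kappa>)" using Bk by (simp add: mult_ac)
      \<comment> \<open>The constant is 13/36 * 9/2 = 13/8.\<close>
      also have "\<dots> = s\<^sup>2 * (1 / (4 * \<kappa>\<^sup>2) + 13 / 8 * \<kappa>)"
        using s(1) k1 by (simp add: \<kappa>_def power_mult_distrib field_simps)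
      also have "\<dots> \<le> s\<^sup>2 * 2" by (intro mult_left_mono balanced_rate_bound \<kappa>) simp
      finally show "message_variance k (C * (real d * real k / (real n - 1))) x \<le> 2 * (C * real d / (4 * real n)) powr (2 / 3)"
        unfolding s2 B(3) by simp
    qed
  qed
qed

section \<open>Assembly of the stated error bound\<close>

lemma rate_conv:
  fixes a d n e G :: real
  assumes "0 < a" "0 < d" "0 < n" "0 < e"
  shows "2 * d\<^sup>2 / (n * G) * (a * d / (n * e)) powr (2 / 3) =
    2 * a powr (2 / 3) * d powr (8 / 3) / (G * n powr (5 / 3) * e powr (2 / 3))"
proof -
  have "d powr (8 / 3) = d powr (2 + 2 / 3)" "n powr (5 / 3) = n powr (1 + 2 / 3)" by simp_all
  then have "d powr (8 / 3) = d\<^sup>2 * d powr (2 / 3)" "n powr (5 / 3) = n * n powr (2 / 3)"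
    using assms unfolding powr_add by (simp_all add: powr_numeral)
  then show ?thesis by (simp add: powr_mult powr_divide mult_ac)
qed

theorem mainTheorem3:
  fixes d n :: nat and \<epsilon> \<delta> :: real
  assumes "d = CARD('d::finite)"
    and "n \<ge> 2"
    and "0 < \<epsilon>" and "\<epsilon> < 6"
    and "0 < \<delta>" and "\<delta> \<le> 1"
    and "\<exists>k\<ge>1. gamma_param d n \<epsilon> \<delta> k < 1"
  shows "\<exists>k \<gamma>. k \<ge> 1 \<and> \<gamma> = gamma_param d n \<epsilon> \<delta> k \<and> \<gamma> < 1 \<and>
    differentially_private (neighbouring n)
      (shuffled_messages k \<gamma> n :: 'd dataset \<Rightarrow> 'd message list pmf) \<epsilon> \<delta> \<and>
    normalized_mse TYPE('d) k \<gamma> n \<le>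
      (if \<epsilon> < 1
       then max
         (98 powr (1/3) * real d powr (8/3) * ln (2 / \<delta>) powr (2/3)
            / ((1 - \<gamma>)\<^sup>2 * real n powr (5/3) * \<epsilon> powr (4/3)))
         (18 * real d powr (8/3)
            / ((1 - \<gamma>)\<^sup>2 * real n powr (5/3) * (4 * \<epsilon>) powr (2/3)))
       else max
         (2 * real d powr (8/3) * (20 * ln (2 / \<delta>)) powr (2/3)
            / ((1 - \<gamma>)\<^sup>2 * real n powr (5/3) * \<epsilon> powr (4/3)))
         (2 * 9 powr (2/3) * real d powr (8/3)
            / ((1 - \<gamma>)\<^sup>2 * real n powr (5/3) * (11 * \<epsilon>) powr (2/3))))"
proof -
  define C where "C = noise_coeff \<epsilon> \<delta>"
  have C: "40 / 27 \<le> C" using noise_coeff_ge assms by (simp add: C_def)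
  have d: "d \<ge> 1" using assms(1) by simp
  have L: "0 < ln (2 / \<delta>)" using assms by (simp add: field_simps)
  have \<gamma>_conv: "gamma_param d n \<epsilon> \<delta> k = C * (real d * real k / (real n - 1))" for k
    using assms(2) by (simp add: gamma_param_conv C_def)
  obtain k\<^sub>0 where k\<^sub>0: "k\<^sub>0 \<ge> 1" "C * (real d * real k\<^sub>0 / (real n - 1)) < 1"
    using assms(7) by (auto simp: \<gamma>_conv)
  \<comment> \<open>The noise level grows with the resolution, so feasibility at any
    \<open>k\<^sub>0\<close> gives feasibility at 1.\<close>
  have "C * (real d / (real n - 1)) \<le> C * (real d * real k\<^sub>0 / (real n - 1))"
    using C assms(2) k\<^sub>0(1) by (intro mult_left_mono divide_right_mono) (auto simp: mult_le_cancel_left1)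
  then have "C * (real d / (real n - 1)) < 1" using k\<^sub>0(2) by linarith
  from exists_resolution[OF assms(2) d C this]
  obtain k where k: "k \<ge> 1" "gamma_param d n \<epsilon> \<delta> k < 1"
    "\<And>x. 0 \<le> x \<Longrightarrow> x \<le> 1 \<Longrightarrow> message_variance k (gamma_param d n \<epsilon> \<delta> k) x
      \<le> 2 * (C * real d / (4 * real n)) powr (2 / 3)"
    unfolding \<gamma>_conv by metis
  define \<gamma> where "\<gamma> = gamma_param d n \<epsilon> \<delta> k"
  define G where "G = (1 - \<gamma>)\<^sup>2"
  have \<gamma>: "0 \<le> \<gamma>" "\<gamma> < 1" using k C assms(2) by (simp_all add: \<gamma>_def \<gamma>_conv)
  have "mse TYPE('d) k \<gamma> n \<le> real n * (2 * (C * real d / (4 * real n)) powr (2 / 3) / G)"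
    unfolding G_def by (rule mse_le) (use \<gamma> k \<gamma>_def in auto)
  then have "normalized_mse TYPE('d) k \<gamma> n \<le> real n * (2 * (C * real d / (4 * real n)) powr (2 / 3) / G) / (real n / real d)\<^sup>2"
    unfolding normalized_mse_def assms(1)[symmetric] by (intro divide_right_mono) auto
  also have "\<dots> = 2 * (real d)\<^sup>2 / (real n * G) * (C * real d / (4 * real n)) powr (2 / 3)"
    using assms(2) d by (simp add: power2_eq_square mult_ac)
  finally have mse: "normalized_mse TYPE('d) k \<gamma> n \<le> 2 * (real d)\<^sup>2 / (real n * G) * (C * real d / (4 * real n)) powr (2 / 3)" .
  \<comment> \<open>Writing \<open>C = 4 * a / e\<close> turns each entry of the maximum in the
    noise level into the matching entry of the error bound; \<open>a\<close> is
    \<open>7 / 2 * ln (2 / \<delta>)\<close>, 27, \<open>20 * ln (2 / \<delta>)\<close> or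
    9.\<close>
  have rate: "normalized_mse TYPE('d) k \<gamma> n \<le>
      2 * a powr (2 / 3) * real d powr (8 / 3) / (G * real n powr (5 / 3) * e powr (2 / 3))"
    if "C = 4 * a / e" "0 < a" "0 < e" for a e
  proof -
    have "C * real d / (4 * real n) = a * real d / (real n * e)" using that by simp
    then have "2 * (real d)\<^sup>2 / (real n * G) * (C * real d / (4 * real n)) powr (2 / 3) =
        2 * a powr (2 / 3) * real d powr (8 / 3) / (G * real n powr (5 / 3) * e powr (2 / 3))"
      using rate_conv[of a "real d" "real n" e G] that assms(2) d by (simp only:)
    then show ?thesis using mse by (simp only:)
  qed
  have sq: "(\<epsilon>\<^sup>2) powr (2 / 3) = \<epsilon> powr (4 / 3)"
    using assms(3) by (simp add: powr_numeral[symmetric] powr_powr del: powr_numeral)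
  have "normalized_mse TYPE('d) k \<gamma> n \<le>
      (if \<epsilon> < 1
       then max
         (98 powr (1/3) * real d powr (8/3) * ln (2 / \<delta>) powr (2/3)
            / (G * real n powr (5/3) * \<epsilon> powr (4/3)))
         (18 * real d powr (8/3)
            / (G * real n powr (5/3) * (4 * \<epsilon>) powr (2/3)))
       else max
         (2 * real d powr (8/3) * (20 * ln (2 / \<delta>)) powr (2/3)
            / (G * real n powr (5/3) * \<epsilon> powr (4/3)))
         (2 * 9 powr (2/3) * real d powr (8/3)
            / (G * real n powr (5/3) * (11 * \<epsilon>) powr (2/3))))"
  proof (cases "\<epsilon> < 1")
    case True
    \<comment> \<open>98 = 2^3 * (7/2)^2 brings the target into the form
      \<open>2 * a powr (2 / 3)\<close>; likewise 18 = 2 * 9 with 9 = 27^(2/3).\<close>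
    have "98 powr (1 / 3) = (2 powr 3 * (7 / 2) powr 2 :: real) powr (1 / 3)" by (simp add: powr_numeral power2_eq_square)
    then have c98: "98 powr (1 / 3) = 2 * (7 / 2 :: real) powr (2 / 3)"
      by (simp add: powr_mult powr_powr del: powr_numeral)
    have "27 powr (2 / 3) = (3 powr 3 :: real) powr (2 / 3)" by (simp add: powr_numeral)
    then have c27: "27 powr (2 / 3) = (9 :: real)"
      by (simp add: powr_powr del: powr_numeral)
    \<comment> \<open>\<open>C\<close> equals one of the two entries, and the matching entry of the
      bound lies below its maximum.\<close>
    from True have "C = 4 * (7 / 2 * ln (2 / \<delta>)) / \<epsilon>\<^sup>2 \<or> C = 4 * 27 / (4 * \<epsilon>)"
      by (auto simp: C_def noise_coeff_def max_def)
    then show ?thesis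
    proof
      assume "C = 4 * (7 / 2 * ln (2 / \<delta>)) / \<epsilon>\<^sup>2"
      from rate[OF this, unfolded powr_mult[of "7 / 2"]] L assms(3) have "normalized_mse TYPE('d) k \<gamma> n \<le> 98 powr (1/3) * real d powr (8/3) * ln (2 / \<delta>) powr (2/3)
            / (G * real n powr (5/3) * \<epsilon> powr (4/3))"
        by (simp add: sq c98 mult_ac)
      then show ?thesis using True by (simp add: le_max_iff_disj)
    next
      assume "C = 4 * 27 / (4 * \<epsilon>)"
      from rate[OF this] assms(3) show ?thesis using True by (simp add: c27 le_max_iff_disj)
    qed
  next
    case False
    then have "C = 4 * (20 * ln (2 / \<delta>)) / \<epsilon>\<^sup>2 \<or> C = 4 * 9 / (11 * \<epsilon>)"
      by (auto simp: C_def noise_coeff_def max_def)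
    then show ?thesis
    proof
      assume "C = 4 * (20 * ln (2 / \<delta>)) / \<epsilon>\<^sup>2"
      from rate[OF this] L assms(3) show ?thesis using False by (simp add: sq le_max_iff_disj mult_ac)
    next
      assume "C = 4 * 9 / (11 * \<epsilon>)"
      from rate[OF this] assms(3) show ?thesis using False by (simp add: le_max_iff_disj)
    qed
  qed
  moreover have "differentially_private (neighbouring n)
      (shuffled_messages k \<gamma> n :: 'd dataset \<Rightarrow> 'd message list pmf) \<epsilon> \<delta>"
    using shuffled_messages_private[where 'd = 'd, OF assms(2-6) k(1)] k(2) by (simp add: \<gamma>_def assms(1))
  ultimately show ?thesis
    using k(1) \<gamma>(2) unfolding G_def by (intro exI[of _ k] exI[of _ \<gamma>]) (simp add: \<gamma>_def)
qed

end
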